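(* Let $G$ be a simple connected graph with $n\geq 4$ vertices whose chromatic number $\chi$ satisfies $\frac{n}{2}\leq \chi\leq n-1$, and suppose that the complement of $G$ is disconnected. Then $DLS(G)\geq 2$, with equality if and only if $$G\cong K_{\underbrace{2,2,\dots,2}_{n-\chi},\underbrace{1,1,\dots,1}_{2\chi-n}}.$$
   Context: All graphs are finite, simple and connected (complements may be disconnected). $K_{l_1,\dots,l_k}$ denotes the complete $k$-partite graph with independent classes of cardinalities $l_1,\dots,l_k$; here the graph has $n-\chi$ classes of size $2$ and $2\chi-n$ classes of size $1$. For a connected graph $G$ on vertices $v_1,\dots,v_n$, $d_{uv}$ denotes the distance (length of a shortest path) between $u$ and $v$, and $D(G)=(d_{uv})$ is the distance matrix. The transmission of a vertex $v$ is $Tr(v)=\sum_{u\in V(G)}d_{uv}$. The distance Laplacian matrix is $D^L(G)=\mathrm{diag}(Tr(v_1),\dots,Tr(v_n))-D(G)$; it is positive semidefinite, and its eigenvalues, with multiplicity, are written $\partial_1^L(G)\ge \partial_2^L(G)\ge\dots\ge\partial_n^L(G)=0$. The distance Laplacian spread is $DLS(G)=\partial_1^L(G)-\partial_{n-1}^L(G)$. *)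

theory Defs
  imports "Graph_Theory.Graph_Theory" "Jordan_Normal_Form.Char_Poly"
begin

text \<open>
  A finite simple undirected graph is a \<^locale>\<open>pair_graph\<close>: a finite, loop-free digraph with
  a symmetric arc relation, each edge being represented by its two opposite arcs.
\<close>

definition graph_complement :: "'a pair_pre_digraph \<Rightarrow> 'a pair_pre_digraph" where
  "graph_complement G =
     \<lparr> pverts = pverts G,
       parcs = {(u, v). u \<in> pverts G \<and> v \<in> pverts G \<and> u \<noteq> v \<and> (u, v) \<notin> parcs G} \<rparr>"

definition proper_colouring :: "'a pair_pre_digraph \<Rightarrow> nat \<Rightarrow> ('a \<Rightarrow> nat) \<Rightarrow> bool" where
  "proper_colouring G k c \<longleftrightarrow>
     (\<forall>v \<in> pverts G. c v < k) \<and> (\<forall>(u, v) \<in> parcs G. c u \<noteq> c v)"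

definition chromatic_number :: "'a pair_pre_digraph \<Rightarrow> nat" where
  "chromatic_number G = (LEAST k. \<exists>c. proper_colouring G k c)"

text \<open>
  The complete multipartite graph with independent classes of sizes \<open>ls ! 0, ls ! 1, \<dots>\<close>;
  the vertex \<open>(i, j)\<close> is the \<open>j\<close>-th element of the \<open>i\<close>-th class.
\<close>

definition complete_multipartite :: "nat list \<Rightarrow> (nat \<times> nat) pair_pre_digraph" where
  "complete_multipartite ls =
     (let V = {(i, j). i < length ls \<and> j < ls ! i}
      in \<lparr> pverts = V, parcs = {(u, v). u \<in> V \<and> v \<in> V \<and> fst u \<noteq> fst v} \<rparr>)"

text \<open>The \<open>LEAST\<close> is over a nonempty set when \<open>G\<close> is connected.\<close>

definition graph_dist :: "'a pair_pre_digraph \<Rightarrow> 'a \<Rightarrow> 'a \<Rightarrow> nat" where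
  "graph_dist G u v = (LEAST k. \<exists>p. pre_digraph.apath (with_proj G) u p v \<and> length p = k)"

definition transmission :: "'a pair_pre_digraph \<Rightarrow> 'a \<Rightarrow> nat" where
  "transmission G v = (\<Sum>u \<in> pverts G. graph_dist G u v)"

text \<open>
  Matrices are taken with respect to an enumeration \<open>vs\<close> of the vertices (a distinct list with
  \<open>set vs = pverts G\<close>).
\<close>

definition distance_matrix :: "'a pair_pre_digraph \<Rightarrow> 'a list \<Rightarrow> real mat" where
  "distance_matrix G vs =
     mat (length vs) (length vs) (\<lambda>(i, j). real (graph_dist G (vs ! i) (vs ! j)))"

definition transmission_matrix :: "'a pair_pre_digraph \<Rightarrow> 'a list \<Rightarrow> real mat" where
  "transmission_matrix G vs =
     mat (length vs) (length vs) (\<lambda>(i, j). if i = j then real (transmission G (vs ! i)) else 0)"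

definition distance_laplacian :: "'a pair_pre_digraph \<Rightarrow> 'a list \<Rightarrow> real mat" where
  "distance_laplacian G vs = transmission_matrix G vs - distance_matrix G vs"

text \<open>
  Real eigenvalues with algebraic multiplicity, in non-increasing order. For a symmetric real
  matrix of dimension \<open>n\<close> this list has length \<open>n\<close>, and algebraic and geometric multiplicities
  agree.
\<close>

definition eigenvalues_desc :: "real mat \<Rightarrow> real list" where
  "eigenvalues_desc A = rev (sorted_list_of_multiset (proots (char_poly A)))"

text \<open>Numbered from 1: the largest eigenvalue is the one with \<open>i = 1\<close>.\<close>

definition distance_laplacian_eigenvalue :: "'a pair_pre_digraph \<Rightarrow> 'a list \<Rightarrow> nat \<Rightarrow> real" where
  "distance_laplacian_eigenvalue G vs i = eigenvalues_desc (distance_laplacian G vs) ! (i - 1)"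

definition distance_laplacian_spread :: "'a pair_pre_digraph \<Rightarrow> 'a list \<Rightarrow> real" where
  "distance_laplacian_spread G vs =
     distance_laplacian_eigenvalue G vs 1 - distance_laplacian_eigenvalue G vs (length vs - 1)"

end

(*
  If the complement H of G is disconnected, any two non-adjacent vertices of G have a common
  neighbour, so all distances are at most 2 and D^L = n I - J + L(H), with L(H) the Laplacian of H
  and J the all-ones matrix.  On the orthogonal complement of the all-ones vector D^L acts as
  n I + L(H), and disconnectedness of H puts 0 into the spectrum of L(H) there.  Hence the spread is
  the largest eigenvalue of L(H).  H has an edge because chi < n, and an edge forces that eigenvalue
  to be at least 2.  Two edges at a common vertex force it to be at least 3, while a matching has
  Laplacian spectrum inside {0, 2}.  So equality means that H is a matching, i.e. that G is complete
  multipartite with classes of size 1 or 2; the number of classes is then chi.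
*)
theory Submission
  imports Defs "Jordan_Normal_Form.Schur_Decomposition"
begin

section \<open>Real symmetric matrices\<close>

text \<open>The eigenvalues are given as a sorted list of roots of the characteristic polynomial,
  whereas the estimates concern quadratic forms and eigenvectors. An orthonormal eigenbasis of a
  real symmetric matrix connects the two, keeping multiplicities. Multiplicity matters because the
  spread refers to a position in the list: that position holds \<open>n\<close> only if 0 is a
  simple root and no other eigenvalue lies below \<open>n\<close>. Both facts come from a maximum
  principle: at a maximal entry of a vector the Laplacian of H contributes a nonnegative amount. The
  constants 2 and 3 are the largest Laplacian eigenvalues of a single edge and of a path with three
  vertices. Their eigenvectors, extended by 0, serve as test vectors; further edges of H only add
  nonnegative terms. The gap between 2 and 3 is what lets equality detect a matching. The number of
  classes equals the chromatic number for two reasons: colouring by classes bounds it from above,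
  and one representative per class forms a clique.\<close>

lemma real_symmetric_has_eigenvalue:
  fixes A :: "real mat"
  assumes A: "A \<in> carrier_mat n n" and sym: "A\<^sup>T = A" and n: "n \<noteq> 0"
  shows "\<exists>e. eigenvalue A e"
proof -
  let ?c = "complex_of_real"
  define B where "B = map_mat ?c A"
  have B: "B \<in> carrier_mat n n" using A by (simp add: B_def)
  have aij: "A $$ (i,j) = A $$ (j,i)" if "i < n" "j < n" for i j
    using sym A that by (metis carrier_matD index_transpose_mat(1))
  have "degree (char_poly B) \<noteq> 0" using degree_monic_char_poly[OF B] n by simp
  then have "\<not> constant (poly (char_poly B))" by (simp add: constant_degree)
  then obtain z where z: "poly (char_poly B) z = 0"
    using fundamental_theorem_of_algebra by blast
  then have "eigenvalue B z" using eigenvalue_root_char_poly[OF B] by simp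
  then obtain v where v: "v \<in> carrier_vec n" "v \<noteq> 0\<^sub>v n" and Bv: "B *\<^sub>v v = z \<cdot>\<^sub>v v"
    using B unfolding eigenvalue_def eigenvector_def by auto
  \<comment> \<open>\<open>S\<close> is the Hermitian form of \<open>A\<close> at the complex
    eigenvector \<open>v\<close>. Row by row it equals \<open>z * N\<close>, with \<open>N\<close>
    the squared norm of \<open>v\<close>. As \<open>A\<close> is real and symmetric,
    \<open>S\<close> is also its own conjugate, so the root \<open>z\<close> is real.\<close>
  define S where "S = (\<Sum>i<n. \<Sum>j<n. cnj (v $ i) * ?c (A $$ (i,j)) * v $ j)"
  define N where "N = (\<Sum>i<n. (cmod (v $ i))\<^sup>2)"
  have row: "(\<Sum>j<n. ?c (A $$ (i,j)) * v $ j) = z * v $ i" if "i < n" for i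
  proof -
    have "(B *\<^sub>v v) $ i = (\<Sum>j<n. ?c (A $$ (i,j)) * v $ j)"
      using that A v by (simp add: B_def scalar_prod_def lessThan_atLeast0)
    then show ?thesis using Bv that v by simp
  qed
  have "S = (\<Sum>i<n. cnj (v $ i) * (\<Sum>j<n. ?c (A $$ (i,j)) * v $ j))"
    unfolding S_def by (simp add: sum_distrib_left mult.assoc)
  also have "\<dots> = (\<Sum>i<n. z * ?c ((cmod (v $ i))\<^sup>2))"
    by (intro sum.cong refl, subst row) (simp_all only: lessThan_iff complex_norm_square ac_simps)
  also have "\<dots> = z * ?c N" by (simp add: N_def sum_distrib_left)
  finally have S: "S = z * ?c N" .
  have "cnj S = (\<Sum>i<n. \<Sum>j<n. v $ i * ?c (A $$ (i,j)) * cnj (v $ j))"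
    unfolding S_def by (simp add: cnj_sum)
  also have "\<dots> = (\<Sum>j<n. \<Sum>i<n. v $ i * ?c (A $$ (i,j)) * cnj (v $ j))"
    by (rule sum.swap)
  also have "\<dots> = S" unfolding S_def
    by (intro sum.cong refl) (simp add: aij ac_simps)
  finally have "cnj z * ?c N = z * ?c N" using S by simp
  moreover have "N \<noteq> 0"
  proof
    assume "N = 0"
    then have "\<forall>i<n. v $ i = 0" unfolding N_def
      by (subst (asm) sum_nonneg_eq_0_iff) auto
    then show False using v by auto
  qed
  ultimately have "cnj z = z" by simp
  then obtain x where x: "z = ?c x" by (metis Reals_cnj_iff Reals_cases)
  have "char_poly B = map_poly ?c (char_poly A)"
    unfolding B_def by (rule of_real_hom.char_poly_hom[OF A])
  with z have "poly (char_poly A) x = 0" unfolding x by simp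
  then show ?thesis using eigenvalue_root_char_poly[OF A] by blast
qed

text \<open>Gram-Schmidt on a basis that begins with \<open>v\<close> keeps the first vector, and
  dividing by the norms makes the columns orthonormal. The factor \<open>c\<close> is what this
  normalisation does to \<open>v\<close>. Used as the change of basis that splits off one
  eigenvector.\<close>

lemma orthogonal_mat_extending_vec:
  fixes v :: "real vec"
  assumes v: "v \<in> carrier_vec n" and v0: "v \<noteq> 0\<^sub>v n"
  shows "\<exists>W c. W \<in> carrier_mat n n \<and> W\<^sup>T * W = 1\<^sub>m n \<and> col W 0 = c \<cdot>\<^sub>v v"
proof -
  have n: "n \<noteq> 0" using v v0 by auto
  interpret cof_vec_space n "TYPE(real)" .
  define b where "b = basis_completion v"
  define ws where "ws = gram_schmidt n b"
  from basis_completion[OF v v0, folded b_def]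
  have dist_b: "distinct b" and indep: "\<not> lin_dep (set b)" and b: "set b \<subseteq> carrier_vec n"
    and hdb: "hd b = v" and len_b: "length b = n" by auto
  from hdb len_b n obtain vs where bv: "b = v # vs" by (cases b, auto)
  from gram_schmidt_result[OF b dist_b indep refl, folded ws_def]
  have ws: "set ws \<subseteq> carrier_vec n" "corthogonal ws" "length ws = n"
    by (auto simp: len_b)
  from gram_schmidt_hd[OF v, of vs, folded bv] have hdws: "hd ws = v" unfolding ws_def .
  have wsi: "ws ! i \<in> carrier_vec n" if "i < n" for i using ws that by auto
  have conj: "conjugate u = u" for u :: "real vec" by (auto simp: conjugate_vec_def)
  have orth: "(ws ! i \<bullet> ws ! j = 0) = (i \<noteq> j)" if "i < n" "j < n" for i j
    using corthogonalD[OF ws(2)] ws(3) that by (simp add: conj)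
  define f where "f i = 1 / sqrt (ws ! i \<bullet> ws ! i)" for i
  define W where "W = mat_of_cols n (map (\<lambda>i. f i \<cdot>\<^sub>v ws ! i) [0..<n])"
  have W: "W \<in> carrier_mat n n" by (simp add: W_def mat_of_cols_def)
  have col: "col W i = f i \<cdot>\<^sub>v ws ! i" if "i < n" for i
    using that wsi[OF that] unfolding W_def by (subst col_mat_of_cols) auto
  have "W\<^sup>T * W = 1\<^sub>m n"
  proof (rule eq_matI)
    fix i j assume "i < dim_row (1\<^sub>m n :: real mat)" "j < dim_col (1\<^sub>m n :: real mat)"
    then have ij: "i < n" "j < n" by auto
    have pos: "ws ! i \<bullet> ws ! i > 0"
    proof -
      have "ws ! i \<bullet> ws ! i \<ge> 0" by (auto simp: scalar_prod_def intro!: sum_nonneg)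
      then show ?thesis using orth[of i i] ij by simp
    qed
    have "(W\<^sup>T * W) $$ (i,j) = f i * f j * (ws ! i \<bullet> ws ! j)"
      using ij W wsi[of i] wsi[of j] by (simp add: col)
    also have "\<dots> = (if i = j then 1 else 0)"
      using orth[OF ij] pos by (auto simp: f_def)
    finally show "(W\<^sup>T * W) $$ (i,j) = 1\<^sub>m n $$ (i,j)" using ij by simp
  qed (use W in auto)
  moreover have "col W 0 = f 0 \<cdot>\<^sub>v v" using col[of 0] n hdws ws(3) by (cases ws) auto
  ultimately show ?thesis using W by blast
qed

text \<open>Deflation: in an orthonormal basis starting with an eigenvector, a symmetric matrix is
  block diagonal, with the eigenvalue in one corner and a smaller symmetric matrix in the other, to
  which the induction hypothesis applies.\<close>

theorem real_symmetric_orthogonally_diagonalizable: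
  fixes A :: "real mat"
  assumes "A \<in> carrier_mat n n" and "A\<^sup>T = A"
  shows "\<exists>P D. P \<in> carrier_mat n n \<and> D \<in> carrier_mat n n \<and> P\<^sup>T * P = 1\<^sub>m n \<and>
           diagonal_mat D \<and> A = P * D * P\<^sup>T"
  using assms
proof (induction n arbitrary: A)
  case 0
  then show ?case by (intro exI[of _ A]) (auto simp: diagonal_mat_def)
next
  case (Suc n)
  note A = Suc.prems(1) and sym = Suc.prems(2)
  obtain e where "eigenvalue A e" using real_symmetric_has_eigenvalue[OF A sym] by auto
  then obtain v where v: "v \<in> carrier_vec (Suc n)" "v \<noteq> 0\<^sub>v (Suc n)" and Av: "A *\<^sub>v v = e \<cdot>\<^sub>v v"
    using A unfolding eigenvalue_def eigenvector_def by auto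
  obtain W c where W: "W \<in> carrier_mat (Suc n) (Suc n)" and WW: "W\<^sup>T * W = 1\<^sub>m (Suc n)"
    and W0: "col W 0 = c \<cdot>\<^sub>v v" using orthogonal_mat_extending_vec[OF v] by blast
  have WW': "W * W\<^sup>T = 1\<^sub>m (Suc n)"
    using mat_mult_left_right_inverse[OF _ W WW] W by simp
  define B where "B = W\<^sup>T * A * W"
  have B: "B \<in> carrier_mat (Suc n) (Suc n)" using A W by (simp add: B_def)
  have Wt: "W\<^sup>T \<in> carrier_mat (Suc n) (Suc n)" using W by simp
  have Bsym: "B\<^sup>T = B"
  proof -
    have "B\<^sup>T = W\<^sup>T * (W\<^sup>T * A)\<^sup>T" unfolding B_def using W A
      by (subst transpose_mult[of _ "Suc n" "Suc n" _ "Suc n"]) auto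
    also have "(W\<^sup>T * A)\<^sup>T = A * W" using W A sym
      by (subst transpose_mult[of _ "Suc n" "Suc n" _ "Suc n"]) auto
    also have "W\<^sup>T * (A * W) = B" unfolding B_def using W A Wt
      by (subst assoc_mult_mat[of _ "Suc n" "Suc n" _ "Suc n" _ "Suc n"]) auto
    finally show ?thesis .
  qed
  \<comment> \<open>The first column of \<open>W\<close> is an eigenvector, so the first column of
    \<open>B\<close> is \<open>e\<close> times a unit vector. Symmetry of \<open>B\<close> then
    clears the first row as well.\<close>
  have col0: "B $$ (i, 0) = (if i = 0 then e else 0)" if "i < Suc n" for i
  proof -
    have "col B 0 = W\<^sup>T *\<^sub>v (A *\<^sub>v col W 0)"
      unfolding B_def using A W Wt
      by (subst col_mult2[OF _ W])
        (auto intro!: assoc_mult_mat_vec[of _ "Suc n" "Suc n" _ "Suc n"] col_carrier_vec[OF _ W])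
    also have "A *\<^sub>v col W 0 = e \<cdot>\<^sub>v col W 0"
      unfolding W0 using A v Av by (simp add: mult_mat_vec smult_smult_assoc mult.commute)
    also have "W\<^sup>T *\<^sub>v (e \<cdot>\<^sub>v col W 0) = e \<cdot>\<^sub>v (W\<^sup>T *\<^sub>v col W 0)"
      by (rule mult_mat_vec[OF Wt]) (rule col_carrier_vec[OF _ W], simp)
    also have "W\<^sup>T *\<^sub>v col W 0 = col (W\<^sup>T * W) 0" using col_mult2[OF Wt W] by simp
    finally have "col B 0 = e \<cdot>\<^sub>v unit_vec (Suc n) 0" by (simp add: WW)
    then have "col B 0 $ i = (e \<cdot>\<^sub>v unit_vec (Suc n) 0) $ i" by simp
    then show ?thesis using that B by simp
  qed
  have Bij: "B $$ (i,j) = B $$ (j,i)" if "i < Suc n" "j < Suc n" for i j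
    using Bsym B that by (metis carrier_matD index_transpose_mat(1))
  define C where "C = mat n n (\<lambda>(i,j). B $$ (Suc i, Suc j))"
  have C: "C \<in> carrier_mat n n" by (simp add: C_def)
  have "C\<^sup>T = C" by (rule eq_matI) (auto simp: C_def Bij)
  from Suc.IH[OF C this] obtain Q E where Q: "Q \<in> carrier_mat n n" and E: "E \<in> carrier_mat n n"
    and QQ: "Q\<^sup>T * Q = 1\<^sub>m n" and dE: "diagonal_mat E" and CQ: "C = Q * E * Q\<^sup>T" by blast
  let ?o = "1\<^sub>m 1 :: real mat" and ?zr = "0\<^sub>m 1 n :: real mat" and ?zc = "0\<^sub>m n 1 :: real mat"
  let ?e = "mat 1 1 (\<lambda>_. e)"
  \<comment> \<open>The smaller orthogonal matrix is bordered by a 1, leaving the split-off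
    eigenvector fixed; \<open>W * Q'\<close> then diagonalises \<open>A\<close>.\<close>
  define Q' where "Q' = four_block_mat ?o ?zr ?zc Q"
  define D where "D = four_block_mat ?e ?zr ?zc E"
  have Q': "Q' \<in> carrier_mat (Suc n) (Suc n)" using Q unfolding Q'_def
    using four_block_carrier_mat[of ?o 1 1 Q n n] by simp
  have D: "D \<in> carrier_mat (Suc n) (Suc n)" using E unfolding D_def
    using four_block_carrier_mat[of ?e 1 1 E n n] by simp
  have Q't: "Q'\<^sup>T = four_block_mat ?o ?zr ?zc (Q\<^sup>T)"
    unfolding Q'_def by (rule eq_matI) (use Q in \<open>auto simp: four_block_mat_def\<close>)
  have QQ': "Q'\<^sup>T * Q' = 1\<^sub>m (Suc n)"
    unfolding Q't unfolding Q'_def using Q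
    by (subst mult_four_block_mat[of _ 1 1 _ n _ n _ _ 1 _ n]) (auto simp: QQ four_block_one_mat[symmetric])
  have B_block: "B = four_block_mat ?e ?zr ?zc C"
  proof (rule eq_matI)
    fix i j assume "i < dim_row (four_block_mat ?e ?zr ?zc C)" "j < dim_col (four_block_mat ?e ?zr ?zc C)"
    then have ij: "i < Suc n" "j < Suc n" using C by auto
    show "B $$ (i,j) = four_block_mat ?e ?zr ?zc C $$ (i,j)"
      using ij C col0[of i] col0[of j] Bij[of 0 j]
      by (cases i; cases j) (auto simp: four_block_mat_def C_def)
  qed (use B C in auto)
  have BQ: "B = Q' * D * Q'\<^sup>T"
  proof -
    have "Q' * D = four_block_mat ?e ?zr ?zc (Q * E)"
      unfolding Q'_def D_def using Q E
      by (subst mult_four_block_mat[of _ 1 1 _ n _ n _ _ 1 _ n]) auto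
    also have "\<dots> * Q'\<^sup>T = four_block_mat ?e ?zr ?zc (Q * E * Q\<^sup>T)"
      unfolding Q't using Q E
      by (subst mult_four_block_mat[of _ 1 1 _ n _ n _ _ 1 _ n]) auto
    finally show ?thesis using B_block CQ by simp
  qed
  have dD: "diagonal_mat D"
    unfolding diagonal_mat_def
  proof (intro allI impI)
    fix i j assume ij: "i < dim_row D" "j < dim_col D" "i \<noteq> j"
    then show "D $$ (i,j) = 0" using dE E
      by (cases i; cases j) (auto simp: D_def diagonal_mat_def)
  qed
  define P where "P = W * Q'"
  have P: "P \<in> carrier_mat (Suc n) (Suc n)" using W Q' by (simp add: P_def)
  have Q't_c: "Q'\<^sup>T \<in> carrier_mat (Suc n) (Suc n)" using Q' by simp
  note am = assoc_mult_mat[of _ "Suc n" "Suc n" _ "Suc n" _ "Suc n"]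
  have Pt: "(W * Q')\<^sup>T = Q'\<^sup>T * W\<^sup>T" by (rule transpose_mult[OF W Q'])
  have "P\<^sup>T * P = Q'\<^sup>T * (W\<^sup>T * W) * Q'"
    unfolding P_def Pt using W Q' Wt Q't_c by (simp add: am)
  then have PP: "P\<^sup>T * P = 1\<^sub>m (Suc n)" using WW QQ' Q't_c by simp
  have "P * D * P\<^sup>T = W * B * W\<^sup>T"
    unfolding P_def Pt BQ using W Q' Wt Q't_c D by (simp add: am)
  also have "\<dots> = (W * W\<^sup>T) * A * (W * W\<^sup>T)"
    unfolding B_def using W Wt A by (simp add: am)
  also have "\<dots> = A" using A by (simp add: WW')
  finally show ?case using P D PP dD by metis
qed

section \<open>From a diagonal form to the list of eigenvalues\<close>

lemma proots_linear_factors: "proots (\<Prod>a\<leftarrow>as. [:- a, 1:]) = mset (as :: 'a :: idom list)"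
proof (induction as)
  case (Cons a as)
  have "(\<Prod>a\<leftarrow>as. [:- a, 1:]) \<noteq> 0" by (auto simp: prod_list_zero_iff)
  then show ?case using Cons by (simp add: proots_mult del: mult_pCons_left)
qed simp

text \<open>Coordinate form of the diagonalisation: \<open>p k\<close> is the \<open>k\<close>-th
  column of \<open>P\<close> and \<open>d k\<close> the matching diagonal entry, in no particular
  order. Index functions replace vectors so that everything becomes plain sums. The third and fourth
  facts give Rayleigh bounds; the last ties \<open>d\<close> to the roots with multiplicity.\<close>

lemma real_symmetric_spectral_decomposition:
  fixes A :: "real mat"
  assumes A: "A \<in> carrier_mat n n" and sym: "A\<^sup>T = A"
  obtains p :: "nat \<Rightarrow> nat \<Rightarrow> real" and d :: "nat \<Rightarrow> real" where
    "\<And>k i. k < n \<Longrightarrow> i < n \<Longrightarrow> (\<Sum>j<n. A $$ (i,j) * p k j) = d k * p k i"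
    "\<And>k l. k < n \<Longrightarrow> l < n \<Longrightarrow> (\<Sum>j<n. p k j * p l j) = (if k = l then 1 else 0)"
    "\<And>x. (\<Sum>i<n. \<Sum>j<n. x i * A $$ (i,j) * x j) = (\<Sum>k<n. d k * (\<Sum>j<n. p k j * x j)\<^sup>2)"
    "\<And>x. (\<Sum>i<n. (x i)\<^sup>2) = (\<Sum>k<n. (\<Sum>j<n. p k j * x j)\<^sup>2)"
    "proots (char_poly A) = image_mset d (mset_set {..<n})"
proof -
  obtain P D where P: "P \<in> carrier_mat n n" and D: "D \<in> carrier_mat n n"
    and PP: "P\<^sup>T * P = 1\<^sub>m n" and dD: "diagonal_mat D" and AP: "A = P * D * P\<^sup>T"
    using real_symmetric_orthogonally_diagonalizable[OF A sym] by blast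
  have PP': "P * P\<^sup>T = 1\<^sub>m n" using mat_mult_left_right_inverse[OF _ P PP] P by simp
  define p where "p k j = P $$ (j,k)" for k j
  define d where "d k = D $$ (k,k)" for k
  have orth: "(\<Sum>j<n. p k j * p l j) = (if k = l then 1 else 0)" if "k < n" "l < n" for k l
  proof -
    have "(P\<^sup>T * P) $$ (k,l) = (\<Sum>j<n. p k j * p l j)"
      using that P by (simp add: scalar_prod_def p_def lessThan_atLeast0)
    then show ?thesis using that by (simp add: PP)
  qed
  \<comment> \<open>The rows of \<open>P\<close> are orthonormal too; this completeness relation is
    what yields the norm identity.\<close>
  have orth': "(\<Sum>k<n. p k i * p k j) = (if i = j then 1 else 0)" if "i < n" "j < n" for i j
  proof -
    have "(P * P\<^sup>T) $$ (i,j) = (\<Sum>k<n. p k i * p k j)"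
      using that P by (simp add: scalar_prod_def p_def lessThan_atLeast0)
    then show ?thesis using that by (simp add: PP')
  qed
  have PD: "(P * D) $$ (i,k) = d k * p k i" if "i < n" "k < n" for i k
  proof -
    have "(P * D) $$ (i,k) = (\<Sum>l<n. P $$ (i,l) * D $$ (l,k))"
      using that P D by (simp add: scalar_prod_def lessThan_atLeast0)
    also have "\<dots> = (\<Sum>l<n. if l = k then d k * p k i else 0)"
      using that D dD by (intro sum.cong) (auto simp: diagonal_mat_def d_def p_def)
    finally show ?thesis using that by simp
  qed
  have aij: "A $$ (i,j) = (\<Sum>k<n. d k * p k i * p k j)" if "i < n" "j < n" for i j
  proof -
    have "A $$ (i,j) = (\<Sum>k<n. (P * D) $$ (i,k) * P $$ (j,k))"
      unfolding AP using that P D by (subst index_mult_mat) (auto simp: scalar_prod_def lessThan_atLeast0)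
    then show ?thesis using that by (simp add: PD p_def)
  qed
  show ?thesis
  proof (rule that)
    fix k i assume ki: "k < n" "i < n"
    have "(\<Sum>j<n. A $$ (i,j) * p k j) = (\<Sum>j<n. \<Sum>l<n. d l * p l i * (p l j * p k j))"
      using ki by (intro sum.cong) (simp_all add: aij sum_distrib_right sum_distrib_left mult.assoc)
    also have "\<dots> = (\<Sum>l<n. d l * p l i * (\<Sum>j<n. p l j * p k j))"
      by (subst sum.swap) (simp add: sum_distrib_left)
    also have "\<dots> = (\<Sum>l<n. if l = k then d l * p l i else 0)"
      using ki by (intro sum.cong) (auto simp: orth)
    finally show "(\<Sum>j<n. A $$ (i,j) * p k j) = d k * p k i" using ki by simp
  next
    fix x :: "nat \<Rightarrow> real"
    have *: "(\<Sum>j<n. p k j * x j)\<^sup>2 = (\<Sum>i<n. \<Sum>j<n. x i * (p k i * p k j) * x j)" for k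
      by (simp add: power2_eq_square sum_product ac_simps)
    have "(\<Sum>k<n. d k * (\<Sum>j<n. p k j * x j)\<^sup>2)
        = (\<Sum>k<n. \<Sum>i<n. \<Sum>j<n. x i * (d k * p k i * p k j) * x j)"
      unfolding * by (simp add: sum_distrib_left ac_simps)
    also have "\<dots> = (\<Sum>i<n. \<Sum>j<n. \<Sum>k<n. x i * (d k * p k i * p k j) * x j)"
      by (subst sum.swap, rule sum.cong[OF refl], rule sum.swap)
    also have "\<dots> = (\<Sum>i<n. \<Sum>j<n. x i * A $$ (i,j) * x j)"
      by (intro sum.cong refl) (simp add: aij sum_distrib_left sum_distrib_right)
    finally show "(\<Sum>i<n. \<Sum>j<n. x i * A $$ (i,j) * x j) = (\<Sum>k<n. d k * (\<Sum>j<n. p k j * x j)\<^sup>2)" ..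
    have "(\<Sum>k<n. (\<Sum>j<n. p k j * x j)\<^sup>2)
        = (\<Sum>i<n. \<Sum>j<n. \<Sum>k<n. x i * (p k i * p k j) * x j)"
      unfolding * by (subst sum.swap, rule sum.cong[OF refl], rule sum.swap)
    also have "\<dots> = (\<Sum>i<n. \<Sum>j<n. x i * (\<Sum>k<n. p k i * p k j) * x j)"
      by (simp add: sum_distrib_left sum_distrib_right)
    also have "\<dots> = (\<Sum>i<n. \<Sum>j<n. if j = i then (x i)\<^sup>2 else 0)"
      by (intro sum.cong refl) (auto simp: orth' power2_eq_square)
    also have "\<dots> = (\<Sum>i<n. (x i)\<^sup>2)" by simp
    finally show "(\<Sum>i<n. (x i)\<^sup>2) = (\<Sum>k<n. (\<Sum>j<n. p k j * x j)\<^sup>2)" ..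
  next
    have "similar_mat_wit A D P (P\<^sup>T)"
      by (rule similar_mat_witI[of _ _ n]) (use P D A AP PP PP' in auto)
    then have "char_poly A = char_poly D"
      by (intro char_poly_similar) (auto simp: similar_mat_def)
    also have "\<dots> = (\<Prod>a\<leftarrow>diag_mat D. [:- a, 1:])"
      using dD D by (intro char_poly_upper_triangular) (auto simp: diagonal_mat_def)
    finally have "proots (char_poly A) = mset (diag_mat D)" by (simp add: proots_linear_factors)
    also have "\<dots> = image_mset d (mset_set {..<n})"
      unfolding lessThan_atLeast0 using D by (simp add: diag_mat_def d_def[abs_def])
    finally show "proots (char_poly A) = image_mset d (mset_set {..<n})" .
  qed (rule orth)
qed

text \<open>In increasing order the roots begin \<open>0, m\<close>, so \<open>m\<close> is at
  position \<open>n - 2\<close>, counted from 0, of the decreasing list. A second zero would occupy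
  that place, hence the demand that 0 be simple.\<close>

lemma eigenvalues_desc_two_smallest:
  assumes nn: "n \<ge> 2" and M: "proots (char_poly A) = M" "size M = n"
    and c: "count M 0 = 1" and m_prop: "m \<in># M" "m > 0" "\<forall>x\<in>#M. x \<noteq> 0 \<longrightarrow> m \<le> x"
  shows "eigenvalues_desc A ! (n - 2) = m"
    and "eigenvalues_desc A ! 0 \<in># M" and "\<And>x. x \<in># M \<Longrightarrow> x \<le> eigenvalues_desc A ! 0"
proof -
  have "0 \<in># M" using c by (metis count_greater_eq_one_iff le_refl)
  then obtain M1 where M1: "M = add_mset 0 M1" by (metis insert_DiffM)
  then have "m \<in># M1" using m_prop by auto
  then obtain M2 where M2: "M1 = add_mset m M2" by (metis insert_DiffM)
  have n0: "0 \<notin># M1" using c M1 by (simp add: not_in_iff)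
  then have ge: "x \<ge> m" if "x \<in># M1" for x using m_prop(3) that M1 by auto
  define s where "s = sorted_list_of_multiset M"
  define s2 where "s2 = sorted_list_of_multiset M2"
  have "sorted_list_of_multiset M1 = m # s2"
    unfolding M2 s2_def sorted_list_of_multiset_insert by (rule insort_is_Cons) (use ge M2 in auto)
  then have s: "s = 0 # m # s2"
    unfolding s_def M1 sorted_list_of_multiset_insert using m_prop(2) by simp
  have len: "length s = n" using M(2) by (metis mset_sorted_list_of_multiset s_def size_mset)
  have e: "eigenvalues_desc A = rev s" by (simp add: eigenvalues_desc_def M s_def)
  show "eigenvalues_desc A ! (n - 2) = m" unfolding e using s len by (auto simp: nth_append)
  have e0: "eigenvalues_desc A ! 0 = s ! (n - 1)" unfolding e using len nn by (simp add: rev_nth)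
  have set_s: "set s = set_mset M" by (simp add: s_def)
  show "eigenvalues_desc A ! 0 \<in># M" unfolding e0 set_s[symmetric] using len nn by simp
  fix x assume "x \<in># M"
  then obtain i where "i < n" "x = s ! i" using set_s len by (metis in_set_conv_nth)
  then show "x \<le> eigenvalues_desc A ! 0" unfolding e0 
    using len sorted_sorted_list_of_multiset[of M] by (auto simp: s_def intro!: sorted_nth_mono)
qed

section \<open>The matrix nI - J + L\<close>

lemma proots_char_poly_of_eigenfunction:
  fixes A :: "real mat"
  assumes A: "A \<in> carrier_mat n n"
    and ev: "\<And>i. i < n \<Longrightarrow> (\<Sum>j<n. A $$ (i,j) * x j) = c * x i" and nz: "i < n" "x i \<noteq> 0"
  shows "c \<in># proots (char_poly A)"
proof -
  have "eigenvector A (vec n x) c"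
    unfolding eigenvector_def
  proof (intro conjI)
    show "vec n x \<noteq> 0\<^sub>v (dim_row A)" using nz A by (metis carrier_matD(1) index_vec index_zero_vec(1))
    show "A *\<^sub>v vec n x = c \<cdot>\<^sub>v vec n x"
      by (rule eq_vecI) (use A ev in \<open>auto simp: scalar_prod_def lessThan_atLeast0\<close>)
  qed (use A in simp)
  then have "poly (char_poly A) c = 0"
    using eigenvalue_root_char_poly[OF A] unfolding eigenvalue_def by blast
  moreover have "char_poly A \<noteq> 0" using degree_monic_char_poly[OF A] by auto
  ultimately show ?thesis by simp
qed

text \<open>The entries of n I - J + L, where L is the Laplacian of the graph \<open>R\<close> on
  \<open>{..<n}\<close>: an off-diagonal entry is -1 from J, lowered once more on an edge. Working
  with indices and an abstract relation separates the spectral estimates from distances and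
  digraphs.\<close>

locale shifted_laplacian =
  fixes n :: nat and R :: "nat \<Rightarrow> nat \<Rightarrow> bool" and A :: "real mat"
  assumes R_sym: "R i j \<Longrightarrow> R j i" and R_irrefl: "\<not> R i i"
    and A_carrier: "A \<in> carrier_mat n n"
    and A_diag: "i < n \<Longrightarrow> A $$ (i,i) = real (n - 1) + real (card {j. j < n \<and> R i j})"
    and A_off_diag: "i < n \<Longrightarrow> j < n \<Longrightarrow> i \<noteq> j \<Longrightarrow> A $$ (i,j) = (if R i j then -2 else -1)"
begin

text \<open>The three terms come from n I, J and L. On vectors with sum zero the middle term
  vanishes, and on constant vectors everything cancels. The estimates below see \<open>A\<close>
  through this identity.\<close>

lemma mult_eq:
  assumes i: "i < n"
  shows "(\<Sum>j<n. A $$ (i,j) * x j)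
    = real n * x i - (\<Sum>j<n. x j) + (\<Sum>j | j < n \<and> R i j. x i - x j)"
proof -
  let ?N = "{j. j < n \<and> R i j}"
  have "(\<Sum>j<n. A $$ (i,j) * x j)
      = (\<Sum>j<n. (if j = i then (real n + real (card ?N)) * x i else 0) - x j - (if R i j then x j else 0))"
    using i by (intro sum.cong) (auto simp: A_diag A_off_diag R_irrefl algebra_simps of_nat_diff)
  also have "\<dots> = (real n + real (card ?N)) * x i - (\<Sum>j<n. x j) - (\<Sum>j<n. if R i j then x j else 0)"
    using i by (simp add: sum_subtractf)
  also have "(\<Sum>j<n. if R i j then x j else 0) = (\<Sum>j\<in>?N. x j)"
    by (intro sum.mono_neutral_cong_right) auto
  finally show ?thesis by (simp add: sum_subtractf algebra_simps)
qed

lemma A_symmetric: "A\<^sup>T = A"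
proof (rule eq_matI)
  fix i j assume "i < dim_row A" "j < dim_col A"
  then have "i < n" "j < n" using A_carrier by auto
  then show "A\<^sup>T $$ (i,j) = A $$ (i,j)"
    using A_carrier R_sym by (cases "i = j") (auto simp: A_off_diag)
qed (use A_carrier in auto)

text \<open>The all-ones vector lies in the kernel, so by symmetry the columns of \<open>A\<close>
  sum to 0. Summing the eigenvalue equation over all rows leaves \<open>c\<close> times the sum of
  \<open>x\<close> equal to 0.\<close>

lemma sum_eq_0:
  assumes ev: "\<And>i. i < n \<Longrightarrow> (\<Sum>j<n. A $$ (i,j) * x j) = c * x i" and c: "c \<noteq> 0"
  shows "(\<Sum>i<n. x i) = 0"
proof -
  have row: "(\<Sum>i<n. A $$ (i,j)) = 0" if "j < n" for j
  proof -
    have "(\<Sum>i<n. A $$ (i,j)) = (\<Sum>i<n. A $$ (j,i) * 1)"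
      using that A_symmetric A_carrier
      by (intro sum.cong) (metis carrier_matD index_transpose_mat(1) lessThan_iff mult.right_neutral)+
    then show ?thesis using mult_eq[OF that, of "\<lambda>_. 1"] by simp
  qed
  have "c * (\<Sum>i<n. x i) = (\<Sum>i<n. \<Sum>j<n. A $$ (i,j) * x j)"
    by (simp add: ev sum_distrib_left)
  also have "\<dots> = (\<Sum>j<n. (\<Sum>i<n. A $$ (i,j)) * x j)"
    by (subst sum.swap) (simp add: sum_distrib_right)
  also have "\<dots> = 0" by (simp add: row)
  finally show ?thesis using c by simp
qed

text \<open>Maximum principle: \<open>x\<close> is nonzero with sum zero, so its maximal entry is
  positive. In that row the Laplacian term is nonnegative, and the row reads
  \<open>c * x k >= n * x k\<close>.\<close>

lemma eigenvalue_ge: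
  assumes ev: "\<And>i. i < n \<Longrightarrow> (\<Sum>j<n. A $$ (i,j) * x j) = c * x i" and nz: "i < n" "x i \<noteq> 0"
    and c: "c \<noteq> 0"
  shows "c \<ge> real n"
proof -
  have s0: "(\<Sum>i<n. x i) = 0" by (rule sum_eq_0[OF ev c])
  have "\<exists>k<n. x k > 0"
  proof (rule ccontr)
    assume "\<not> ?thesis"
    then have le: "\<And>k. k < n \<Longrightarrow> - x k \<ge> 0" by (metis linorder_not_less neg_0_le_iff_le)
    have "(\<Sum>i<n. - x i) = 0" using s0 by (simp add: sum_negf)
    then show False using sum_nonneg_eq_0_iff[of "{..<n}" "\<lambda>i. - x i"] le nz by auto
  qed
  then obtain k0 where k0: "k0 < n" "x k0 > 0" by auto
  define m where "m = Max (x ` {..<n})"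
  have "m \<in> x ` {..<n}" unfolding m_def using nz by (intro Max_in) auto
  then obtain k where k: "k < n" "x k = m" by auto
  have le: "x j \<le> x k" if "j < n" for j unfolding k(2) m_def using that by auto
  have pos: "x k > 0" using le[OF k0(1)] k0 by simp
  have "(\<Sum>j | j < n \<and> R k j. x k - x j) \<ge> 0" by (rule sum_nonneg) (use le in auto)
  then have "c * x k \<ge> real n * x k" using mult_eq[OF k(1), of x] ev[OF k(1)] s0 by simp
  then show ?thesis using pos by simp
qed

text \<open>In the row of a maximal entry \<open>x k\<close> the Laplacian term is nonnegative,
  which leaves the sum of the nonnegative numbers \<open>x k - x j\<close> at most 0; so all of them
  vanish. This makes 0 a simple eigenvalue even when \<open>R\<close> is disconnected.\<close>

lemma kernel_const:
  assumes ev: "\<And>i. i < n \<Longrightarrow> (\<Sum>j<n. A $$ (i,j) * x j) = 0"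
  shows "\<exists>c. \<forall>i<n. x i = c"
proof (cases "n = 0")
  case False
  define m where "m = Max (x ` {..<n})"
  have "m \<in> x ` {..<n}" unfolding m_def using False by (intro Max_in) auto
  then obtain k where k: "k < n" "x k = m" by auto
  have le: "x j \<le> x k" if "j < n" for j unfolding k(2) m_def using that by auto
  have "(\<Sum>j | j < n \<and> R k j. x k - x j) \<ge> 0" by (rule sum_nonneg) (use le in auto)
  then have "(\<Sum>j<n. x k - x j) \<le> 0"
    using mult_eq[OF k(1), of x] ev[OF k(1)] by (simp add: sum_subtractf)
  moreover have nn: "\<forall>j\<in>{..<n}. x k - x j \<ge> 0" using le by auto
  ultimately have "(\<Sum>j<n. x k - x j) = 0" by (intro antisym sum_nonneg) auto
  then have "\<forall>j\<in>{..<n}. x k - x j = 0" using nn by (subst (asm) sum_nonneg_eq_0_iff) auto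
  then show ?thesis by (intro exI[of _ "x k"]) auto
qed simp

text \<open>\<open>S\<close> is a union of components of \<open>R\<close>. The three conclusions are
  proved together because they share one eigenbasis. The hypothesis of
  \<open>largest_eigenvalue_ge\<close> is a row-wise form of x^T L x >= c |x|^2, convenient for test
  vectors with few nonzero entries.\<close>

lemma
  assumes S: "S \<subset> {..<n}" "S \<noteq> {}" and cut: "\<forall>i\<in>S. \<forall>j<n. R i j \<longrightarrow> j \<in> S"
  shows second_smallest_eigenvalue: "eigenvalues_desc A ! (n - 2) = real n"
    and largest_eigenvalue_ge: "\<And>x c k.
      (\<Sum>i<n. x i) = 0 \<Longrightarrow> k < n \<Longrightarrow> x k \<noteq> 0 \<Longrightarrow>
      (\<And>i. i < n \<Longrightarrow> (\<Sum>j | j < n \<and> R i j. x i * (x i - x j)) \<ge> c * (x i)\<^sup>2) \<Longrightarrow>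
      eigenvalues_desc A ! 0 \<ge> real n + c"
    and largest_eigenvalue_le:
      "(\<And>i j k. i < n \<Longrightarrow> j < n \<Longrightarrow> k < n \<Longrightarrow> R i j \<Longrightarrow> R i k \<Longrightarrow> j = k) \<Longrightarrow>
      eigenvalues_desc A ! 0 \<le> real n + 2"
proof -
  obtain p d where
    ev: "\<And>k i. k < n \<Longrightarrow> i < n \<Longrightarrow> (\<Sum>j<n. A $$ (i,j) * p k j) = d k * p k i"
    and orth: "\<And>k l. k < n \<Longrightarrow> l < n \<Longrightarrow> (\<Sum>j<n. p k j * p l j) = (if k = l then 1 else 0)"
    and form: "\<And>x. (\<Sum>i<n. \<Sum>j<n. x i * A $$ (i,j) * x j) = (\<Sum>k<n. d k * (\<Sum>j<n. p k j * x j)\<^sup>2)"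
    and norm: "\<And>x. (\<Sum>i<n. (x i)\<^sup>2) = (\<Sum>k<n. (\<Sum>j<n. p k j * x j)\<^sup>2)"
    and roots: "proots (char_poly A) = image_mset d (mset_set {..<n})"
    by (rule real_symmetric_spectral_decomposition[OF A_carrier A_symmetric]) blast
  define M where "M = image_mset d (mset_set {..<n})"
  have M: "x \<in># M \<longleftrightarrow> (\<exists>k<n. x = d k)" for x unfolding M_def by auto
  have pnz: "\<exists>i<n. p k i \<noteq> 0" if "k < n" for k
  proof (rule ccontr)
    assume "\<not> ?thesis"
    then have "(\<Sum>j<n. p k j * p k j) = 0" by simp
    then show False using orth[OF that that] by simp
  qed
  obtain s where s: "s \<in> S" "s < n" using S by auto
  have "0 \<in># proots (char_poly A)"
  proof (rule proots_char_poly_of_eigenfunction[OF A_carrier])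
    show "(\<Sum>j<n. A $$ (i,j) * 1) = 0 * 1" if "i < n" for i
      by (subst mult_eq[OF that]) simp
  qed (use s in auto)
  then obtain k0 where k0: "k0 < n" "d k0 = 0" using M roots M_def by auto
  \<comment> \<open>A second kernel vector of the basis would be constant, like \<open>p k0\<close>,
    and orthogonal to it. Then one of the two constants is 0, although basis vectors are
    nonzero.\<close>
  have uniq: "d k \<noteq> 0" if "k < n" "k \<noteq> k0" for k
  proof
    assume "d k = 0"
    then have "(\<Sum>j<n. A $$ (i,j) * p k j) = 0" "(\<Sum>j<n. A $$ (i,j) * p k0 j) = 0" if "i < n" for i
      using ev[OF \<open>k < n\<close> that] ev[OF k0(1) that] k0 by simp_all
    then obtain c c0 where c: "\<forall>i<n. p k i = c" and c0: "\<forall>i<n. p k0 i = c0"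
      using kernel_const[of "p k"] kernel_const[of "p k0"] by blast
    have "(\<Sum>j<n. p k j * p k0 j) = real n * (c * c0)" by (simp add: c c0)
    then have "c = 0 \<or> c0 = 0" using orth[OF that(1) k0(1)] that by auto
    then show False using pnz[OF that(1)] pnz[OF k0(1)] c c0 by auto
  qed
  have "mset_set {..<n} = add_mset k0 (mset_set ({..<n} - {k0}))"
    using k0 by (simp add: mset_set.remove)
  then have "count M 0 = count (image_mset d (mset_set ({..<n} - {k0}))) 0 + 1"
    by (simp add: M_def k0)
  also have "count (image_mset d (mset_set ({..<n} - {k0}))) 0 = 0"
    using uniq by (subst not_in_iff[symmetric]) (auto, blast)
  finally have count: "count M 0 = 1" by simp
  define a b where "a = real (card S)" and "b = real (card ({..<n} - S))"
  have finS: "finite S" using S finite_subset by blast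
  have ab: "a > 0" "b > 0"
    unfolding a_def b_def using S finS by (auto simp: card_gt_0_iff)
  \<comment> \<open>Weighting each side of the cut by the size of the other gives sum zero. No edge
    of \<open>R\<close> crosses the cut and \<open>y\<close> is constant on both sides, so L y = 0
    and \<open>y\<close> is an eigenvector for \<open>n\<close>.\<close>
  define y where "y i = (if i \<in> S then b else - a)" for i
  have "(\<Sum>i<n. y i) = (\<Sum>i\<in>S. y i) + (\<Sum>i\<in>{..<n}-S. y i)"
    using S by (metis finite_lessThan psubset_imp_subset sum.subset_diff add.commute)
  also have "\<dots> = a * b - b * a" by (simp add: y_def a_def b_def)
  finally have y0: "(\<Sum>i<n. y i) = 0" by simp
  have yR: "(\<Sum>j | j < n \<and> R i j. y i - y j) = 0" if "i < n" for i
  proof (rule sum.neutral, rule ballI)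
    fix j assume "j \<in> {j. j < n \<and> R i j}"
    then have "i \<in> S \<longleftrightarrow> j \<in> S" using cut R_sym[of i j] R_sym[of j i] that by auto
    then show "y i - y j = 0" by (simp add: y_def)
  qed
  have nM: "real n \<in># M" unfolding M_def roots[symmetric]
    by (rule proots_char_poly_of_eigenfunction[OF A_carrier, of y _ s])
      (use s ab in \<open>simp_all add: mult_eq y0 yR\<close>, simp add: y_def)
  have ge: "x \<ge> real n" if "x \<in># M" "x \<noteq> 0" for x
  proof -
    from iffD1[OF M that(1)] obtain k where k: "k < n" "x = d k" by (elim exE conjE)
    from pnz[OF k(1)] obtain i where i: "i < n" "p k i \<noteq> 0" by (elim exE conjE)
    show ?thesis unfolding k(2) by (rule eigenvalue_ge[OF ev[OF k(1)] i]) (use k that in simp_all)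
  qed
  have n2: "n \<ge> 2"
  proof -
    have "card S < n" using S psubset_card_mono[of "{..<n}" S] by simp
    moreover have "card S > 0" using S finS by (simp add: card_gt_0_iff)
    ultimately show ?thesis by simp
  qed
  have npos: "real n > 0" using n2 by simp
  have sz: "size M = n" by (simp add: M_def)
  have "\<forall>x\<in>#M. x \<noteq> 0 \<longrightarrow> real n \<le> x" using ge by blast
  note e = eigenvalues_desc_two_smallest[OF n2 roots[folded M_def] sz count nM npos this]
  show "eigenvalues_desc A ! (n - 2) = real n" by (rule e(1))
  define m where "m = eigenvalues_desc A ! 0"
  have d_le: "d k \<le> m" if "k < n" for k unfolding m_def 
    by (rule e(3), rule iffD2[OF M]) (use that in blast)
  show "eigenvalues_desc A ! 0 \<ge> real n + c"
    if x: "(\<Sum>i<n. x i) = 0" "k < n" "x k \<noteq> 0"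
      "\<And>i. i < n \<Longrightarrow> (\<Sum>j | j < n \<and> R i j. x i * (x i - x j)) \<ge> c * (x i)\<^sup>2" for x c k
  proof -
    \<comment> \<open>Rayleigh quotient: the row-wise bound gives a lower estimate of the quadratic
      form of \<open>A\<close> at \<open>x\<close>, and expansion in the eigenbasis bounds the form
      above by \<open>m\<close> times the squared norm.\<close>
    have "(real n + c) * (\<Sum>i<n. (x i)\<^sup>2) = (\<Sum>i<n. real n * (x i)\<^sup>2 + c * (x i)\<^sup>2)"
      by (simp add: sum_distrib_left algebra_simps sum.distrib)
    also have "\<dots> \<le> (\<Sum>i<n. real n * (x i)\<^sup>2 + (\<Sum>j | j < n \<and> R i j. x i * (x i - x j)))"
      by (intro sum_mono add_left_mono x) simp
    also have "\<dots> = (\<Sum>i<n. x i * (\<Sum>j<n. A $$ (i,j) * x j))"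
      by (intro sum.cong refl, subst mult_eq)
        (simp_all add: x(1) power2_eq_square distrib_left sum_distrib_left mult.left_commute)
    also have "\<dots> = (\<Sum>i<n. \<Sum>j<n. x i * A $$ (i,j) * x j)"
      by (simp add: sum_distrib_left mult.assoc)
    also have "\<dots> = (\<Sum>k<n. d k * (\<Sum>j<n. p k j * x j)\<^sup>2)" by (rule form)
    also have "\<dots> \<le> (\<Sum>k<n. m * (\<Sum>j<n. p k j * x j)\<^sup>2)"
      by (rule sum_mono, rule mult_right_mono) (simp_all add: d_le)
    also have "\<dots> = m * (\<Sum>i<n. (x i)\<^sup>2)" unfolding norm[of x] by (rule sum_distrib_left[symmetric])
    finally have "(real n + c) * (\<Sum>i<n. (x i)\<^sup>2) \<le> m * (\<Sum>i<n. (x i)\<^sup>2)" .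
    moreover have "(\<Sum>i<n. (x i)\<^sup>2) > 0" by (rule sum_pos2[of _ k]) (use x in auto)
    ultimately show ?thesis by (simp add: m_def)
  qed
  show "eigenvalues_desc A ! 0 \<le> real n + 2"
    if match: "\<And>i j k. i < n \<Longrightarrow> j < n \<Longrightarrow> k < n \<Longrightarrow> R i j \<Longrightarrow> R i k \<Longrightarrow> j = k"
  proof -
    obtain k where k: "k < n" "m = d k" using iffD1[OF M e(2)] unfolding m_def by (elim exE conjE)
    have "m \<noteq> 0" using e(3)[OF nM] npos by (simp add: m_def)
    then have s0: "(\<Sum>i<n. p k i) = 0" using sum_eq_0[of "p k" m] ev k by simp
    \<comment> \<open>In the row \<open>i\<close> of largest modulus \<open>t\<close>, a matching
      leaves at most one Laplacian term, of modulus at most \<open>2 * t\<close>. This term equals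
      \<open>(m - n) * p k i\<close>, so \<open>m - n\<close> has modulus at most 2.\<close>
    define t where "t = Max ((\<lambda>i. \<bar>p k i\<bar>) ` {..<n})"
    have "t \<in> (\<lambda>i. \<bar>p k i\<bar>) ` {..<n}" unfolding t_def using k by (intro Max_in) auto
    then obtain i where i: "i < n" "\<bar>p k i\<bar> = t" by auto
    have le: "\<bar>p k j\<bar> \<le> t" if "j < n" for j unfolding t_def using that by auto
    obtain i0 where "i0 < n" "p k i0 \<noteq> 0" using pnz[OF k(1)] by auto
    then have tpos: "t > 0" using le[of i0] by auto
    have "\<bar>\<Sum>j | j < n \<and> R i j. p k i - p k j\<bar> \<le> 2 * t"
    proof (cases "\<exists>j<n. R i j")
      case True
      then obtain j where j: "j < n" "R i j" by auto
      then have "{j. j < n \<and> R i j} = {j}" using match i by blast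
      then have "\<bar>\<Sum>j | j < n \<and> R i j. p k i - p k j\<bar> = \<bar>p k i - p k j\<bar>" by simp
      then show ?thesis using le[OF j(1)] le[OF i(1)] by linarith
    next
      case False
      then have empty: "{j. j < n \<and> R i j} = {}" by auto
      show ?thesis unfolding empty using tpos by simp
    qed
    moreover have "(m - real n) * p k i = (\<Sum>j | j < n \<and> R i j. p k i - p k j)"
      using mult_eq[OF i(1), of "p k"] ev[OF k(1) i(1)] k s0 by (simp add: algebra_simps)
    ultimately have "\<bar>m - real n\<bar> * t \<le> 2 * t" by (metis abs_mult i(2))
    then have "\<bar>m - real n\<bar> \<le> 2" using tpos by simp
    then show ?thesis by (simp add: m_def)
  qed
qed

section \<open>Test vectors for the largest eigenvalue\<close>

context
  fixes S
  assumes S: "S \<subset> {..<n}" "S \<noteq> {}" and cut: "\<forall>i\<in>S. \<forall>j<n. R i j \<longrightarrow> j \<in> S"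
begin

text \<open>The test vector is the Laplacian eigenvector of a single edge for the eigenvalue 2,
  extended by 0.\<close>

lemma largest_eigenvalue_ge_2:
  assumes uv: "u < n" "v < n" "R u v"
  shows "eigenvalues_desc A ! 0 \<ge> real n + 2"
proof -
  define x :: "nat \<Rightarrow> real" where "x i = (if i = u then 1 else if i = v then -1 else 0)" for i
  have neq: "u \<noteq> v" using uv R_irrefl by metis
  show ?thesis
  proof (rule largest_eigenvalue_ge[OF S cut, where x = x and k = u])
    have "(\<Sum>i<n. x i) = (\<Sum>i\<in>{u, v}. x i)"
      by (rule sum.mono_neutral_right) (use uv in \<open>auto simp: x_def\<close>)
    then show "(\<Sum>i<n. x i) = 0" using neq by (simp add: x_def)
    fix i assume i: "i < n"
    let ?f = "\<lambda>j. x i * (x i - x j)"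
    \<comment> \<open>Dropping neighbours only lowers the sum: the positive value of
      \<open>x\<close> is its maximum and the negative one its minimum, so every term is
      nonnegative.\<close>
    have sum_ge: "(\<Sum>j | j < n \<and> R i j. ?f j) \<ge> (\<Sum>j\<in>T. ?f j)"
      if "T \<subseteq> {j. j < n \<and> R i j}" for T
      by (rule sum_mono2) (use that in \<open>auto simp: x_def\<close>)
    consider "i = u" | "i = v" | "i \<noteq> u" "i \<noteq> v" by blast
    then show "2 * (x i)\<^sup>2 \<le> (\<Sum>j | j < n \<and> R i j. ?f j)"
    proof cases
      case 1 then show ?thesis using sum_ge[of "{v}"] uv neq by (simp add: x_def)
    next
      case 2 then show ?thesis using sum_ge[of "{u}"] uv neq R_sym[OF uv(3)] by (simp add: x_def)
    next
      case 3 then show ?thesis using sum_ge[of "{}"] by (simp add: x_def)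
    qed
  qed (use uv in \<open>simp_all add: x_def\<close>)
qed

text \<open>Here it is the Laplacian eigenvector of the path \<open>u\<close>, \<open>w\<close>,
  \<open>v\<close> for the eigenvalue 3: the row of \<open>w\<close> gives at least 6 + 6 = 3 * 4,
  those of \<open>u\<close> and \<open>v\<close> at least 3. An edge between \<open>u\<close> and
  \<open>v\<close> would contribute 0.\<close>

lemma largest_eigenvalue_ge_3:
  assumes uvw: "u < n" "v < n" "w < n" "R w u" "R w v" "u \<noteq> v"
  shows "eigenvalues_desc A ! 0 \<ge> real n + 3"
proof -
  define x :: "nat \<Rightarrow> real"
    where "x i = (if i = w then 2 else if i = u \<or> i = v then -1 else 0)" for i
  have neq: "u \<noteq> w" "v \<noteq> w" using uvw R_irrefl by metis+
  show ?thesis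
  proof (rule largest_eigenvalue_ge[OF S cut, where x = x and k = w])
    have "(\<Sum>i<n. x i) = (\<Sum>i\<in>{u, v, w}. x i)"
      by (rule sum.mono_neutral_right) (use uvw in \<open>auto simp: x_def\<close>)
    then show "(\<Sum>i<n. x i) = 0" using neq uvw by (simp add: x_def)
    fix i assume i: "i < n"
    let ?f = "\<lambda>j. x i * (x i - x j)"
    have sum_ge: "(\<Sum>j | j < n \<and> R i j. ?f j) \<ge> (\<Sum>j\<in>T. ?f j)"
      if "T \<subseteq> {j. j < n \<and> R i j}" for T
      by (rule sum_mono2) (use that in \<open>auto simp: x_def\<close>)
    consider "i = w" | "i = u \<or> i = v" | "i \<noteq> w" "i \<noteq> u" "i \<noteq> v" by blast
    then show "3 * (x i)\<^sup>2 \<le> (\<Sum>j | j < n \<and> R i j. ?f j)"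
    proof cases
      case 1 then show ?thesis using sum_ge[of "{u, v}"] uvw neq by (simp add: x_def)
    next
      case 2 then show ?thesis using sum_ge[of "{w}"] uvw neq R_sym[OF uvw(4)] R_sym[OF uvw(5)] by (auto simp: x_def)
    next
      case 3 then show ?thesis using sum_ge[of "{}"] by (simp add: x_def)
    qed
  qed (use uvw in \<open>simp_all add: x_def\<close>)
qed

end

end

section \<open>Distances and colourings\<close>

lemma chromatic_number_le: "proper_colouring G k c \<Longrightarrow> chromatic_number G \<le> k"
  unfolding chromatic_number_def by (rule Least_le) blast

context pair_graph
begin

text \<open>Giving all vertices different colours is proper, so the minimum defining the chromatic
  number is attained.\<close>

lemma ex_proper_colouring: "\<exists>c. proper_colouring G (chromatic_number G) c"
proof -
  obtain c where c: "bij_betw c (pverts G) {..<card (pverts G)}"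
    using pair_finite_verts finite_same_card_bij[of "pverts G" "{..<card (pverts G)}"] by auto
  have "proper_colouring G (card (pverts G)) c"
    unfolding proper_colouring_def
  proof (intro conjI ballI)
    show "c v < card (pverts G)" if "v \<in> pverts G" for v
      using bij_betwE[OF c] that by auto
    show "case e of (u, v) \<Rightarrow> c u \<noteq> c v" if "e \<in> parcs G" for e
      using that c in_arcsD1 in_arcsD2 no_loops' by (fastforce simp: bij_betw_def dest: inj_onD)
  qed
  then show ?thesis unfolding chromatic_number_def by (intro LeastI[of "\<lambda>k. \<exists>c. proper_colouring G k c"] exI)
qed

text \<open>Serves twice: to find an edge of the complement when the chromatic number is below
  \<open>n\<close>, and to bound the number of classes in the equality case.\<close>

lemma card_clique_le_chromatic_number:
  assumes K: "K \<subseteq> pverts G" and adj: "\<And>u v. u \<in> K \<Longrightarrow> v \<in> K \<Longrightarrow> u \<noteq> v \<Longrightarrow> (u, v) \<in> parcs G"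
  shows "card K \<le> chromatic_number G"
proof -
  obtain c where c: "proper_colouring G (chromatic_number G) c" using ex_proper_colouring by blast
  have "c u \<noteq> c v" if "u \<in> K" "v \<in> K" "u \<noteq> v" for u v
    using c adj[OF that] by (auto simp: proper_colouring_def)
  then have "inj_on c K" by (meson inj_onI)
  moreover have "c ` K \<subseteq> {..<chromatic_number G}" using c K by (auto simp: proper_colouring_def)
  ultimately show ?thesis using card_inj_on_le[of c K "{..<chromatic_number G}"] by simp
qed

section \<open>Distances 0, 1 and 2\<close>

lemma graph_dist_self:
  assumes "u \<in> pverts G"
  shows "graph_dist G u u = 0"
  unfolding graph_dist_def
  by (rule Least_eq_0, rule exI[of _ "[]"]) (use assms in \<open>simp add: apath_def awalk_def\<close>)

lemma graph_dist_adjacent: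
  assumes uv: "(u, v) \<in> parcs G"
  shows "graph_dist G u v = 1"
  unfolding graph_dist_def
proof (rule Least_equality)
  show "\<exists>p. apath u p v \<and> length p = 1"
    by (rule exI[of _ "[(u, v)]"])
      (use uv in_arcsD1[OF uv] no_loops'[OF uv] in \<open>simp add: apath_def awalk_def\<close>)
  fix k assume "\<exists>p. apath u p v \<and> length p = k"
  then obtain p where p: "awalk u p v" "length p = k" by (auto simp: apath_def)
  then show "1 \<le> k" using no_loops'[OF uv] by (cases p) (auto simp: awalk_def)
qed

lemma graph_dist_common_neighbour:
  assumes uv: "u \<noteq> v" "(u, v) \<notin> parcs G" and w: "(u, w) \<in> parcs G" "(w, v) \<in> parcs G"
  shows "graph_dist G u v = 2"
  unfolding graph_dist_def
proof (rule Least_equality)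
  show "\<exists>p. apath u p v \<and> length p = 2"
    by (rule exI[of _ "[(u, w), (w, v)]"])
      (use uv w in_arcsD1[OF w(1)] no_loops'[OF w(1)] no_loops'[OF w(2)] in
        \<open>simp add: apath_def awalk_def\<close>)
  fix k assume "\<exists>p. apath u p v \<and> length p = k"
  then obtain p where p: "awalk u p v" "length p = k" by (auto simp: apath_def)
  show "2 \<le> k"
  proof (rule ccontr)
    assume "\<not> 2 \<le> k"
    then consider "p = []" | e where "p = [e]"
      using p(2) by (cases p; cases "tl p") auto
    then show False using p(1) uv by cases (auto simp: awalk_def)
  qed
qed

section \<open>The cut given by a disconnected complement\<close>

lemma disconnected_complement_cut:
  assumes ne: "pverts G \<noteq> {}" and dc: "\<not> Digraph_Component.connected (with_proj (graph_complement G))"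
  obtains S where "S \<subset> pverts G" "S \<noteq> {}"
    "\<And>u v. u \<in> S \<Longrightarrow> v \<in> pverts G \<Longrightarrow> v \<notin> S \<Longrightarrow> (u, v) \<in> parcs G"
proof -
  \<comment> \<open>\<open>connected\<close> means strong connectivity of the symmetric closure, so
    reachability is taken there.\<close>
  let ?H = "mk_symmetric (with_proj (graph_complement G))"
  have pvC: "pverts (graph_complement G) = pverts G" by (simp add: graph_complement_def)
  have "\<not> (\<forall>a\<in>pverts G. \<forall>b\<in>pverts G. a \<rightarrow>\<^sup>*\<^bsub>with_proj ?H\<^esub> b)"
    using ne dc by (auto simp: connected_def strongly_connected_def pvC)
  then obtain a b where ab: "a \<in> pverts G" "b \<in> pverts G" "\<not> a \<rightarrow>\<^sup>*\<^bsub>with_proj ?H\<^esub> b"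
    by blast
  \<comment> \<open>\<open>S\<close> is the component of \<open>a\<close> in the complement. A pair
    leaving \<open>S\<close> that is not adjacent in \<open>G\<close> would be an arc of the
    complement and would extend reachability beyond \<open>S\<close>.\<close>
  define S where "S = {w \<in> pverts G. a \<rightarrow>\<^sup>*\<^bsub>with_proj ?H\<^esub> w}"
  have "a \<in> S" using ab by (auto simp: S_def reachable_def pvC)
  moreover have "b \<notin> S" using ab by (simp add: S_def)
  moreover have "(u, v) \<in> parcs G" if "u \<in> S" "v \<in> pverts G" "v \<notin> S" for u v
  proof (rule ccontr)
    assume "(u, v) \<notin> parcs G"
    then have "(u, v) \<in> parcs ?H"
      using that unfolding mk_symmetric_def graph_complement_def S_def by force
    then have "a \<rightarrow>\<^sup>*\<^bsub>with_proj ?H\<^esub> v"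
      using that unfolding S_def reachable_def
      by (auto intro: rtrancl_on_into_rtrancl_on simp: pvC)
    then show False using that by (simp add: S_def)
  qed
  ultimately show ?thesis using ab by (intro that[of S]) (auto simp: S_def)
qed

end

section \<open>Complete multipartite graphs\<close>

text \<open>\<open>digraph_iso\<close> also asks for a map of arcs and for new head and tail
  functions; for pair digraphs all of these are determined by \<open>f\<close>.\<close>

lemma digraph_isoI_pair:
  assumes wf: "pair_wf_digraph G" "pair_wf_digraph H" and f: "bij_betw f (pverts G) (pverts H)"
    and arcs: "\<And>u v. u \<in> pverts G \<Longrightarrow> v \<in> pverts G \<Longrightarrow> (u, v) \<in> parcs G \<longleftrightarrow> (f u, f v) \<in> parcs H"
  shows "digraph_iso (with_proj G) (with_proj H)"
proof -
  interpret G: pair_wf_digraph G by (rule wf)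
  interpret H: pair_wf_digraph H by (rule wf)
  let ?h = "\<lparr>iso_verts = f, iso_arcs = map_prod f f, iso_head = snd, iso_tail = fst\<rparr>"
  have inj: "inj_on f (pverts G)" and im: "f ` pverts G = pverts H" using f by (auto simp: bij_betw_def)
  have sub: "parcs G \<subseteq> pverts G \<times> pverts G" using G.in_arcsD1 G.in_arcsD2 by auto
  have "inj_on (map_prod f f) (parcs G)"
    using map_prod_inj_on[OF inj inj] sub by (rule inj_on_subset)
  then have "pre_digraph.digraph_isomorphism (with_proj G) ?h"
    using inj by (auto simp: G.digraph_isomorphism_def G.wf_digraph_axioms)
  moreover have "map_prod f f ` parcs G = parcs H"
  proof
    show "map_prod f f ` parcs G \<subseteq> parcs H" using arcs sub by auto
    show "parcs H \<subseteq> map_prod f f ` parcs G"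
    proof
      fix e assume e: "e \<in> parcs H"
      obtain x y where xy: "e = (x, y)" by (cases e)
      then have "x \<in> f ` pverts G" "y \<in> f ` pverts G" unfolding im using e H.in_arcsD1 H.in_arcsD2 by auto
      then obtain u v where "u \<in> pverts G" "v \<in> pverts G" "x = f u" "y = f v" by auto
      then show "e \<in> map_prod f f ` parcs G" using e xy arcs by (intro image_eqI[of _ _ "(u, v)"]) auto
    qed
  qed
  then have "with_proj H = app_iso ?h (with_proj G)"
    by (simp add: app_iso_def with_proj_def im)
  ultimately show ?thesis unfolding digraph_iso_def by blast
qed

lemma pair_wf_complete_multipartite: "pair_wf_digraph (complete_multipartite ls)"
  by unfold_locales (auto simp: complete_multipartite_def Let_def)

text \<open>A vertex is sent to the index of its class together with its number in an arbitrary
  enumeration of that class.\<close>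

lemma iso_complete_multipartite:
  assumes wf: "pair_wf_digraph G"
    and fin: "finite (pverts G)" and un: "(\<Union>i<length Xs. Xs ! i) = pverts G"
    and disj: "\<And>i j. i < length Xs \<Longrightarrow> j < length Xs \<Longrightarrow> i \<noteq> j \<Longrightarrow> Xs ! i \<inter> Xs ! j = {}"
    and adj: "\<And>i j u v. i < length Xs \<Longrightarrow> j < length Xs \<Longrightarrow> u \<in> Xs ! i \<Longrightarrow> v \<in> Xs ! j \<Longrightarrow>
                (u, v) \<in> parcs G \<longleftrightarrow> i \<noteq> j"
  shows "digraph_iso (with_proj G) (with_proj (complete_multipartite (map card Xs)))"
proof -
  let ?K = "complete_multipartite (map card Xs)"
  have "\<forall>v\<in>pverts G. \<exists>i. i < length Xs \<and> v \<in> Xs ! i" using un by auto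
  then obtain idx where idx: "\<And>v. v \<in> pverts G \<Longrightarrow> idx v < length Xs \<and> v \<in> Xs ! idx v" by metis
  have "\<exists>g. bij_betw g (Xs ! i) {..<card (Xs ! i)}" if "i < length Xs" for i
  proof -
    have "finite (Xs ! i)" using un fin that by (metis UN_upper finite_subset lessThan_iff)
    then show ?thesis by (intro finite_same_card_bij) auto
  qed
  then obtain g where g: "\<And>i. i < length Xs \<Longrightarrow> bij_betw (g i) (Xs ! i) {..<card (Xs ! i)}" by metis
  have idx_eq: "idx v = i" if "i < length Xs" "v \<in> Xs ! i" for i v
    using disj[of i "idx v"] idx[of v] that un by auto
  define f where "f v = (idx v, g (idx v) v)" for v
  have "bij_betw f (pverts G) (pverts ?K)"
    unfolding bij_betw_def
  proof
    show "inj_on f (pverts G)"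
    proof (rule inj_onI)
      fix u v assume uv: "u \<in> pverts G" "v \<in> pverts G" "f u = f v"
      then have "idx u = idx v" "g (idx v) u = g (idx v) v" by (auto simp: f_def)
      then show "u = v" using g[of "idx v"] idx[OF uv(1)] idx[OF uv(2)]
        by (metis bij_betw_imp_inj_on inj_onD)
    qed
    show "f ` pverts G = pverts ?K"
    proof
      show "f ` pverts G \<subseteq> pverts ?K"
        using idx g bij_betwE by (fastforce simp: f_def complete_multipartite_def Let_def)
      show "pverts ?K \<subseteq> f ` pverts G"
      proof
        fix x assume "x \<in> pverts ?K"
        then obtain i j where x: "x = (i, j)" "i < length Xs" "j < card (Xs ! i)"
          by (auto simp: complete_multipartite_def Let_def)
        then have "j \<in> g i ` (Xs ! i)" using g[OF x(2)] by (simp add: bij_betw_def)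
        then obtain v where v: "v \<in> Xs ! i" "j = g i v" by auto
        then show "x \<in> f ` pverts G"
          using x un idx_eq[OF x(2) v(1)] by (intro image_eqI[of _ _ v]) (auto simp: f_def)
      qed
    qed
  qed
  moreover have "(u, v) \<in> parcs G \<longleftrightarrow> (f u, f v) \<in> parcs ?K" if "u \<in> pverts G" "v \<in> pverts G" for u v
  proof -
    have "f u \<in> pverts ?K" "f v \<in> pverts ?K" using calculation that by (auto simp: bij_betw_def)
    then have "(f u, f v) \<in> parcs ?K \<longleftrightarrow> idx u \<noteq> idx v"
      by (auto simp: complete_multipartite_def Let_def f_def)
    then show ?thesis using adj[of "idx u" "idx v" u v] idx that by auto
  qed
  ultimately show ?thesis by (intro digraph_isoI_pair wf pair_wf_complete_multipartite)
qed

section \<open>Graphs whose complement is a matching\<close>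

definition complement_matching :: "'a pair_pre_digraph \<Rightarrow> bool" where
  "complement_matching G \<longleftrightarrow>
     (\<forall>u v w. (u, v) \<in> parcs (graph_complement G) \<longrightarrow> (u, w) \<in> parcs (graph_complement G) \<longrightarrow> v = w)"

text \<open>Vertices that are not adjacent lie in one class. A vertex with two neighbours in the
  complement would give three vertices of one class with distinct second coordinates, all below
  2.\<close>

lemma iso_complete_multipartite_imp_matching:
  assumes iso: "digraph_iso (with_proj G) (with_proj (complete_multipartite ls))"
    and ls: "\<And>l. l \<in> set ls \<Longrightarrow> l \<le> 2"
  shows "complement_matching G"
  unfolding complement_matching_def
proof (intro allI impI)
  let ?K = "complete_multipartite ls"
  obtain h where h: "pre_digraph.digraph_isomorphism (with_proj G) h" "with_proj ?K = app_iso h (with_proj G)"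
    using iso by (auto simp: digraph_iso_def)
  define f where "f = iso_verts h"
  have inj: "inj_on f (pverts G)"
    and tl: "\<And>e. e \<in> parcs G \<Longrightarrow> f (fst e) = iso_tail h (iso_arcs h e) \<and> f (snd e) = iso_head h (iso_arcs h e)"
    using h(1) by (auto simp: pre_digraph.digraph_isomorphism_def f_def)
  have wf: "wf_digraph (with_proj G)" using h(1) by (simp add: pre_digraph.digraph_isomorphism_def)
  then interpret pair_wf_digraph G by (simp add: wf_digraph_wp_iff)
  have vK: "pverts ?K = f ` pverts G" and aK: "parcs ?K = iso_arcs h ` parcs G"
    and ht: "iso_tail h = fst" "iso_head h = snd"
    using arg_cong[OF h(2), of verts] arg_cong[OF h(2), of arcs]
      arg_cong[OF h(2), of tail] arg_cong[OF h(2), of head] by (simp_all add: f_def)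
  have same: "fst (f u) = fst (f v)" if uv: "(u, v) \<in> parcs (graph_complement G)" for u v
  proof (rule ccontr)
    assume neq: "fst (f u) \<noteq> fst (f v)"
    have V: "u \<in> pverts G" "v \<in> pverts G" using uv by (auto simp: graph_complement_def)
    then have "(f u, f v) \<in> parcs ?K"
      using neq vK by (auto simp: complete_multipartite_def Let_def)
    \<comment> \<open>The arc map of the isomorphism is arbitrary, so the preimage \<open>e\<close>
      of the arc is identified through its end vertices.\<close>
    then obtain e where e: "e \<in> parcs G" "iso_arcs h e = (f u, f v)" unfolding aK by (metis imageE)
    then have "f (fst e) = f u" "f (snd e) = f v" using tl[OF e(1)] ht by auto
    then have "fst e = u" "snd e = v"
      using inj V e(1) arc_fst_in_verts arc_snd_in_verts by (auto dest: inj_onD)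
    then show False using e uv by (auto simp: graph_complement_def)
  qed
  fix u v w assume uv: "(u, v) \<in> parcs (graph_complement G)" and uw: "(u, w) \<in> parcs (graph_complement G)"
  have V: "u \<in> pverts G" "v \<in> pverts G" "w \<in> pverts G" "u \<noteq> v" "u \<noteq> w"
    using uv uw by (auto simp: graph_complement_def)
  have lt: "snd (f x) < 2" if "x \<in> pverts G" for x
  proof -
    have "f x \<in> pverts ?K" using vK that by auto
    then have "fst (f x) < length ls" "snd (f x) < ls ! fst (f x)"
      by (auto simp: complete_multipartite_def Let_def)
    then show ?thesis using ls[of "ls ! fst (f x)"] by auto
  qed
  have neq: "snd (f x) \<noteq> snd (f y)" if "x \<in> pverts G" "y \<in> pverts G" "x \<noteq> y" "fst (f x) = fst (f y)" for x y
    using inj that by (metis inj_onD prod_eqI)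
  show "v = w"
  proof (rule ccontr)
    assume "v \<noteq> w"
    then show False
      using neq[of u v] neq[of u w] neq[of v w] lt[of u] lt[of v] lt[of w] same[OF uv] same[OF uw] V
      by auto
  qed
qed

lemma (in pair_graph) matching_imp_iso_complete_multipartite:
  assumes mt: "complement_matching G"
  defines "n \<equiv> card (pverts G)" and "k \<equiv> chromatic_number G"
  shows "digraph_iso (with_proj G)
           (with_proj (complete_multipartite (replicate (n - k) 2 @ replicate (2 * k - n) 1)))"
proof -
  \<comment> \<open>The closed neighbourhood in the complement: \<open>v\<close> and, if it exists,
    its partner in the matching. These sets are the classes.\<close>
  define cls where "cls v = {w \<in> pverts G. (v, w) \<notin> parcs G}" for v
  have loop: "(v, v) \<notin> parcs G" for v using no_loops' by blast
  have symG: "(u, v) \<in> parcs G \<longleftrightarrow> (v, u) \<in> parcs G" for u v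
    using graph_symmetric by blast
  have mate: "w = w'" if "w \<in> cls v" "w' \<in> cls v" "w \<noteq> v" "w' \<noteq> v" "v \<in> pverts G" for v w w'
    using mt that unfolding complement_matching_def cls_def graph_complement_def by simp blast
  have self: "v \<in> cls v" if "v \<in> pverts G" for v using that loop by (simp add: cls_def)
  have cls_eq: "cls w = cls v" if v: "v \<in> pverts G" and w: "w \<in> cls v" for v w
  proof (cases "w = v")
    case False
    have wV: "w \<in> pverts G" using w by (simp add: cls_def)
    have vw: "v \<in> cls w" using v w symG by (simp add: cls_def)
    have "cls v = {v, w}" using mate[of _ v w] self v w False by blast
    moreover have "cls w = {v, w}" using mate[of _ w v] self wV vw False by blast
    ultimately show ?thesis by simp
  qed simp
  have fin: "finite (cls v)" for v unfolding cls_def using pair_finite_verts by simp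
  have card12: "card (cls v) = 1 \<or> card (cls v) = 2" if v: "v \<in> pverts G" for v
  proof (cases "\<exists>w\<in>cls v. w \<noteq> v")
    case True
    then obtain w where "w \<in> cls v" "w \<noteq> v" by blast
    then have "cls v = {v, w}" using mate[of _ v w] self v by blast
    then show ?thesis using \<open>w \<noteq> v\<close> by auto
  next
    case False
    then have "cls v = {v}" using self v by blast
    then show ?thesis by simp
  qed
  define P where "P = cls ` pverts G"
  have finP: "finite P" by (simp add: P_def pair_finite_verts)
  have disj: "X \<inter> Y = {}" if "X \<in> P" "Y \<in> P" "X \<noteq> Y" for X Y
    using that cls_eq unfolding P_def by blast
  have UP: "\<Union>P = pverts G" using self by (auto simp: P_def cls_def)
  have adj: "(u, v) \<in> parcs G \<longleftrightarrow> X \<noteq> Y" if "X \<in> P" "Y \<in> P" "u \<in> X" "v \<in> Y" for X Y u v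
  proof -
    have uv: "u \<in> pverts G" "v \<in> pverts G" using UP that by auto
    have "X = cls u" "Y = cls v" using that cls_eq unfolding P_def by auto
    moreover have "(u, v) \<notin> parcs G \<longleftrightarrow> v \<in> cls u" using uv by (simp add: cls_def)
    moreover have "v \<in> cls u \<longleftrightarrow> cls u = cls v" using cls_eq self uv by blast
    ultimately show ?thesis by blast
  qed
  have "k \<le> card P"
  proof -
    obtain c where c: "bij_betw c P {..<card P}"
      using finite_same_card_bij[OF finP, of "{..<card P}"] by auto
    have "proper_colouring G (card P) (c \<circ> cls)"
      unfolding proper_colouring_def
    proof (intro conjI ballI)
      show "(c \<circ> cls) v < card P" if "v \<in> pverts G" for v
        using bij_betwE[OF c] that by (auto simp: P_def)
      show "case e of (u, v) \<Rightarrow> (c \<circ> cls) u \<noteq> (c \<circ> cls) v" if "e \<in> parcs G" for e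
      proof -
        obtain u v where e: "e = (u, v)" by (cases e)
        then have uv: "u \<in> pverts G" "v \<in> pverts G" using that in_arcsD1 in_arcsD2 by auto
        then have "cls u \<in> P" "cls v \<in> P" by (auto simp: P_def)
        moreover from this have "cls u \<noteq> cls v" using adj[of "cls u" "cls v" u v] self uv that e by auto
        ultimately show ?thesis using c e by (auto simp: bij_betw_def dest: inj_onD)
      qed
    qed
    then show ?thesis unfolding k_def by (rule chromatic_number_le)
  qed
  moreover have "card P \<le> k"
  \<comment> \<open>A transversal \<open>r\<close> of the classes is a clique, because vertices from
    different classes are adjacent.\<close>
  proof -
    define r where "r X = (SOME x. x \<in> X)" for X :: "'a set"
    have r: "r X \<in> X" if "X \<in> P" for X
    proof -
      have "\<exists>x. x \<in> X" using that self by (auto simp: P_def)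
      then show ?thesis unfolding r_def by (rule someI_ex)
    qed
    have "inj_on r P"
    proof (rule inj_onI, rule ccontr)
      fix X Y assume "X \<in> P" "Y \<in> P" "r X = r Y" "X \<noteq> Y"
      then show False using disj[of X Y] r[of X] r[of Y] by auto
    qed
    then have "card P = card (r ` P)" by (simp add: card_image)
    also have "\<dots> \<le> k" unfolding k_def
    proof (rule card_clique_le_chromatic_number)
      show "r ` P \<subseteq> pverts G" using r UP by blast
      show "(u, v) \<in> parcs G" if "u \<in> r ` P" "v \<in> r ` P" "u \<noteq> v" for u v
        using that r adj by blast
    qed
    finally show ?thesis .
  qed
  ultimately have kP: "k = card P" by simp
  define P1 P2 where "P1 = {X \<in> P. card X = 1}" and "P2 = {X \<in> P. card X = 2}"
  have P12: "P = P1 \<union> P2" "P1 \<inter> P2 = {}" using card12 by (auto simp: P1_def P2_def P_def)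
  have fin12: "finite P1" "finite P2" using finP by (simp_all add: P1_def P2_def)
  have "n = (\<Sum>X\<in>P. card X)" unfolding n_def UP[symmetric]
    by (rule card_Union_disjoint) (use disj fin in \<open>auto simp: P_def pairwise_def disjnt_def\<close>)
  also have "\<dots> = (\<Sum>X\<in>P1. card X) + (\<Sum>X\<in>P2. card X)"
    unfolding P12(1) by (rule sum.union_disjoint) (use fin12 P12(2) in auto)
  also have "\<dots> = card P1 + 2 * card P2" by (simp add: P1_def P2_def)
  finally have nP: "n = card P1 + 2 * card P2" .
  have kP12: "k = card P1 + card P2" unfolding kP P12(1) using fin12 P12(2) by (rule card_Un_disjoint)
  obtain Xs1 Xs2 where Xs: "set Xs1 = P1" "distinct Xs1" "set Xs2 = P2" "distinct Xs2"
    using finite_distinct_list fin12 by metis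
  \<comment> \<open>From \<open>n = card P1 + 2 * card P2\<close> and
    \<open>k = card P1 + card P2\<close> follow \<open>n - k = card P2\<close> and
    \<open>2 * k - n = card P1\<close>, so neither natural subtraction truncates.\<close>
  have len: "length Xs1 = 2 * k - n" "length Xs2 = n - k"
    using Xs distinct_card[of Xs1] distinct_card[of Xs2] nP kP12 by simp_all
  let ?Xs = "Xs2 @ Xs1"
  have "map card Xs1 = replicate (2 * k - n) 1"
    by (rule replicate_eqI) (use Xs len in \<open>auto simp: P1_def\<close>)
  moreover have "map card Xs2 = replicate (n - k) 2"
    by (rule replicate_eqI) (use Xs len in \<open>auto simp: P2_def\<close>)
  ultimately have map: "map card ?Xs = replicate (n - k) 2 @ replicate (2 * k - n) 1" by simp
  have dX: "distinct ?Xs" using Xs P12 by auto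
  have sX: "set ?Xs = P" using Xs P12 by auto
  then have inP: "?Xs ! i \<in> P" if "i < length ?Xs" for i using that nth_mem by blast
  have eqX: "?Xs ! i = ?Xs ! j \<longleftrightarrow> i = j" if "i < length ?Xs" "j < length ?Xs" for i j
    using dX that by (rule nth_eq_iff_index_eq)
  have "?Xs ! i \<inter> ?Xs ! j = {}" if "i < length ?Xs" "j < length ?Xs" "i \<noteq> j" for i j
    by (rule disj[OF inP[OF that(1)] inP[OF that(2)]]) (use eqX[OF that(1,2)] that(3) in simp)
  moreover have "(u, v) \<in> parcs G \<longleftrightarrow> i \<noteq> j"
    if "i < length ?Xs" "j < length ?Xs" "u \<in> ?Xs ! i" "v \<in> ?Xs ! j" for i j u v
    using adj[OF inP[OF that(1)] inP[OF that(2)] that(3,4)] eqX[OF that(1,2)] by simp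
  moreover have "(\<Union>i<length ?Xs. ?Xs ! i) = pverts G"
  proof -
    have "(!) ?Xs ` {..<length ?Xs} = set ?Xs" by (auto simp: set_conv_nth simp del: length_append)
    then show ?thesis using sX UP by simp
  qed
  ultimately show ?thesis unfolding map[symmetric]
    by (intro iso_complete_multipartite[OF pair_wf_digraph pair_finite_verts])
qed

section \<open>The distance Laplacian spread\<close>

text \<open>All distances between distinct vertices are 1, or 2 on edges of the complement. Hence a
  transmission is \<open>n - 1\<close> plus the degree in the complement, which gives exactly the
  entries required by the locale.\<close>

lemma (in pair_graph) distance_laplacian_shifted_laplacian:
  assumes vs: "distinct vs" "set vs = pverts G"
    and S: "S \<subset> pverts G" "S \<noteq> {}"
    and cut: "\<And>u v. u \<in> S \<Longrightarrow> v \<in> pverts G \<Longrightarrow> v \<notin> S \<Longrightarrow> (u, v) \<in> parcs G"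
  shows "shifted_laplacian (length vs)
    (\<lambda>i j. i < length vs \<and> j < length vs \<and> (vs ! i, vs ! j) \<in> parcs (graph_complement G))
    (distance_laplacian G vs)"
proof -
  let ?n = "length vs"
  let ?C = "parcs (graph_complement G)"
  have dist: "graph_dist G u v = (if u = v then 0 else if (u, v) \<in> ?C then 2 else 1)"
    if uv: "u \<in> pverts G" "v \<in> pverts G" for u v
  proof -
    consider "u = v" | "(u, v) \<in> parcs G" | "u \<noteq> v" "(u, v) \<notin> parcs G" by blast
    then show ?thesis
    proof cases
      case 1 then show ?thesis using graph_dist_self uv by simp
    next
      case 2
      then show ?thesis
        using graph_dist_adjacent[OF 2] no_loops'[OF 2] by (simp add: graph_complement_def)
    next
      case 3
      \<comment> \<open>Two vertices that are not adjacent lie on the same side of the cut; any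
        vertex of the other side is adjacent to both.\<close>
      have "\<exists>w. (u, w) \<in> parcs G \<and> (w, v) \<in> parcs G"
      proof (cases "u \<in> S")
        case True
        obtain w where w: "w \<in> pverts G" "w \<notin> S" using S(1) by blast
        have "v \<in> S" using cut[OF True uv(2)] 3 by blast
        then show ?thesis using cut[OF True w] graph_symmetric[OF cut[OF _ w]] by blast
      next
        case False
        obtain w where w: "w \<in> S" using S(2) by blast
        have "v \<notin> S" using cut[of v u] uv 3 False graph_symmetric[of v u] by blast
        then show ?thesis
          using cut[OF w uv(2)] graph_symmetric[OF cut[OF w uv(1) False]] by blast
      qed
      then obtain w where "(u, w) \<in> parcs G" "(w, v) \<in> parcs G" by blast
      then show ?thesis
        using graph_dist_common_neighbour[OF 3] 3 uv by (simp add: graph_complement_def)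
    qed
  qed
  have V: "vs ! i \<in> pverts G" if "i < ?n" for i using nth_mem[OF that] vs(2) by simp
  have inj: "vs ! i = vs ! j \<longleftrightarrow> i = j" if "i < ?n" "j < ?n" for i j
    using vs(1) that by (rule nth_eq_iff_index_eq)
  have Csym: "(u, v) \<in> ?C \<longleftrightarrow> (v, u) \<in> ?C" for u v
    using graph_symmetric[of u v] graph_symmetric[of v u] by (auto simp: graph_complement_def)
  have Cirr: "(u, u) \<notin> ?C" for u by (simp add: graph_complement_def)
  have trans: "transmission G (vs ! i) = (?n - 1) + card {j. j < ?n \<and> (vs ! i, vs ! j) \<in> ?C}"
    if i: "i < ?n" for i
  proof -
    have "transmission G (vs ! i) = (\<Sum>j<?n. graph_dist G (vs ! j) (vs ! i))"
      unfolding transmission_def vs(2)[symmetric]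
      by (rule sum.reindex_bij_betw[OF bij_betw_nth[OF vs(1) refl refl], symmetric])
    also have "\<dots> = (\<Sum>j<?n. (if j = i then 0 else 1) + (if (vs ! i, vs ! j) \<in> ?C then 1 else 0))"
      by (intro sum.cong refl) (use i Csym[of "vs ! i"] Cirr in \<open>simp add: dist V inj\<close>)
    also have "\<dots> = (\<Sum>j\<in>{..<?n} - {i}. 1) + card {j. j < ?n \<and> (vs ! i, vs ! j) \<in> ?C}"
    proof -
      have "(\<Sum>j<?n. if j = i then 0 else 1) = (\<Sum>j\<in>{..<?n} - {i}. 1 :: nat)"
        by (rule sum.mono_neutral_cong_right) auto
      moreover have "(\<Sum>j<?n. if (vs ! i, vs ! j) \<in> ?C then 1 else 0)
          = (\<Sum>j | j < ?n \<and> (vs ! i, vs ! j) \<in> ?C. 1 :: nat)"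
        by (rule sum.mono_neutral_cong_right) auto
      ultimately show ?thesis by (simp add: sum.distrib)
    qed
    finally show ?thesis using i by simp
  qed
  show ?thesis
  proof unfold_locales
    show "distance_laplacian G vs \<in> carrier_mat ?n ?n"
      unfolding distance_laplacian_def distance_matrix_def
      by (intro minus_carrier_mat mat_carrier)
  next
    fix i assume i: "i < ?n"
    then have "{j. j < ?n \<and> i < ?n \<and> j < ?n \<and> (vs ! i, vs ! j) \<in> ?C}
        = {j. j < ?n \<and> (vs ! i, vs ! j) \<in> ?C}" by auto
    then show "distance_laplacian G vs $$ (i, i) = real (?n - 1) +
        real (card {j. j < ?n \<and> i < ?n \<and> j < ?n \<and> (vs ! i, vs ! j) \<in> ?C})"
      using i trans[OF i] graph_dist_self[OF V[OF i]]
      by (simp add: distance_laplacian_def transmission_matrix_def distance_matrix_def)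
  next
    fix i j assume "i < ?n" "j < ?n" "i \<noteq> j"
    then show "distance_laplacian G vs $$ (i, j)
        = (if i < ?n \<and> j < ?n \<and> (vs ! i, vs ! j) \<in> ?C then -2 else -1)"
      by (auto simp: distance_laplacian_def transmission_matrix_def distance_matrix_def dist V inj)
  next
    fix i j assume "i < ?n \<and> j < ?n \<and> (vs ! i, vs ! j) \<in> ?C"
    then show "j < ?n \<and> i < ?n \<and> (vs ! j, vs ! i) \<in> ?C" using Csym by blast
  qed (use Cirr in simp)
qed

theorem theorem4p9:
  fixes G :: "'a pair_pre_digraph" and vs :: "'a list" and n \<chi> :: nat
  assumes "pair_graph G"
    and "Digraph_Component.connected (with_proj G)"
    and "distinct vs" and "set vs = pverts G"
    and "n = card (pverts G)" and "n \<ge> 4"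
    and "\<chi> = chromatic_number G"
    and "real n / 2 \<le> real \<chi>" and "\<chi> \<le> n - 1"
    and "\<not> Digraph_Component.connected (with_proj (graph_complement G))"
  shows "distance_laplacian_spread G vs \<ge> 2 \<and>
    (distance_laplacian_spread G vs = 2 \<longleftrightarrow>
      digraph_iso (with_proj G)
        (with_proj (complete_multipartite (replicate (n - \<chi>) 2 @ replicate (2 * \<chi> - n) 1))))"
proof -
  interpret pair_graph G by (rule assms(1))
  let ?C = "parcs (graph_complement G)"
  define R where "R i j \<longleftrightarrow> i < n \<and> j < n \<and> (vs ! i, vs ! j) \<in> ?C" for i j
  have len: "length vs = n" using distinct_card[OF assms(3)] assms(4,5) by simp
  have "pverts G \<noteq> {}" using assms(5,6) by auto
  then obtain S where S: "S \<subset> pverts G" "S \<noteq> {}"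
    "\<And>u v. u \<in> S \<Longrightarrow> v \<in> pverts G \<Longrightarrow> v \<notin> S \<Longrightarrow> (u, v) \<in> parcs G"
    using disconnected_complement_cut assms(10) by blast
  interpret shifted_laplacian n R "distance_laplacian G vs"
    using distance_laplacian_shifted_laplacian[OF assms(3,4) S] unfolding R_def len .
  \<comment> \<open>The cut \<open>S\<close>, carried over from vertices to their positions in
    \<open>vs\<close>.\<close>
  define T where "T = {i. i < n \<and> vs ! i \<in> S}"
  have idx: "\<exists>i<n. vs ! i = v" if "v \<in> pverts G" for v
    using that assms(4) len by (metis in_set_conv_nth)
  have T: "T \<subset> {..<n}" "T \<noteq> {}"
    using S(1,2) idx unfolding T_def by blast+
  have cut: "\<forall>i\<in>T. \<forall>j<n. R i j \<longrightarrow> j \<in> T"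
    using S(3) unfolding T_def R_def graph_complement_def by auto
  define m where "m = eigenvalues_desc (distance_laplacian G vs) ! 0"
  \<comment> \<open>Eigenvalue number \<open>n - 1\<close>, counted from 1, is the list entry at
    \<open>n - 2\<close>, which the cut makes equal to \<open>n\<close>.\<close>
  have spread: "distance_laplacian_spread G vs = m - real n"
    using second_smallest_eigenvalue[OF T cut] assms(6)
    by (simp add: distance_laplacian_spread_def distance_laplacian_eigenvalue_def len m_def
        numeral_2_eq_2)
  \<comment> \<open>Without edges in the complement all \<open>n\<close> vertices would form a
    clique, contradicting that the chromatic number is at most \<open>n - 1\<close>.\<close>
  have "\<exists>u v. (u, v) \<in> ?C"
  proof (rule ccontr)
    assume "\<not> ?thesis"
    then have "(u, v) \<in> parcs G" if "u \<in> pverts G" "v \<in> pverts G" "u \<noteq> v" for u v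
      using that by (auto simp: graph_complement_def)
    then have "n \<le> \<chi>"
      unfolding assms(5,7) by (intro card_clique_le_chromatic_number) auto
    then show False using assms(6,9) by simp
  qed
  then obtain u v where uv: "(u, v) \<in> ?C" by blast
  then have "u \<in> pverts G" "v \<in> pverts G" by (auto simp: graph_complement_def)
  then obtain i j where ij: "i < n" "j < n" "vs ! i = u" "vs ! j = v" using idx by blast
  then have ge: "m \<ge> real n + 2"
    unfolding m_def using uv ij by (intro largest_eigenvalue_ge_2[OF T cut, of i j]) (simp_all add: R_def)
  have eq: "m = real n + 2 \<longleftrightarrow> complement_matching G"
  proof
    assume m: "m = real n + 2"
    show "complement_matching G"
      unfolding complement_matching_def
    proof (intro allI impI, rule ccontr)
      fix u v w assume C: "(u, v) \<in> ?C" "(u, w) \<in> ?C" "v \<noteq> w"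
      then have "u \<in> pverts G" "v \<in> pverts G" "w \<in> pverts G" by (auto simp: graph_complement_def)
      then obtain i j k where "i < n" "j < n" "k < n" "vs ! i = u" "vs ! j = v" "vs ! k = w"
        using idx by metis
      \<comment> \<open>The shared vertex \<open>u\<close>, at position \<open>i\<close>, is the
        centre of the path in \<open>largest_eigenvalue_ge_3\<close>; \<open>v\<close> and
        \<open>w\<close> are its ends.\<close>
      then have "m \<ge> real n + 3"
        unfolding m_def using C by (intro largest_eigenvalue_ge_3[OF T cut, of j k i]) (auto simp: R_def)
      then show False using m by simp
    qed
  next
    assume "complement_matching G"
    then have "m \<le> real n + 2"
      unfolding m_def
    proof (intro largest_eigenvalue_le[OF T cut])
      fix i j k assume "i < n" "j < n" "k < n" "R i j" "R i k"
      then have "vs ! j = vs ! k"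
        using \<open>complement_matching G\<close> unfolding complement_matching_def R_def by blast
      then show "j = k"
        using nth_eq_iff_index_eq[OF assms(3)] \<open>j < n\<close> \<open>k < n\<close> len by simp
    qed
    then show "m = real n + 2" using ge by simp
  qed
  have "complement_matching G \<longleftrightarrow> digraph_iso (with_proj G)
      (with_proj (complete_multipartite (replicate (n - \<chi>) 2 @ replicate (2 * \<chi> - n) 1)))"
    using matching_imp_iso_complete_multipartite unfolding assms(5,7)
    by (auto elim!: iso_complete_multipartite_imp_matching)
  then show ?thesis using ge eq spread by auto
qed

end
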